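(* Fix an integer $g\ge 0$. For $n,k\ge 1$ let $p(n,k)$ be the number of genus $g$ partitions of $\{1,\ldots,n\}$ with $k$ parts, and let $P(x,y)=\sum_{n,k}p(n,k)x^ny^k$. Then $P(x,y)$ is algebraic (over the field of rational functions in $x$ and $y$). More precisely, there is a rational function $F$ in three variables such that $$P(x,y)=F\left(x,\,y,\,\sqrt{(x+xy-1)^2-4x^2y}\right).$$
   Context: Formal power series have real coefficients, and $\sqrt{(x+xy-1)^2-4x^2y}$ denotes the formal power series square root with constant term $1$. For $n\ge1$ let $\zeta_n=(1,2,\ldots,n)$, and let $z(\cdot)$ be the number of cycles of a permutation (fixed points included). Products of permutations are composed right to left, i.e. $(\alpha^{-1}\zeta_n)(i)=\alpha^{-1}(\zeta_n(i))$. The genus $g(\alpha)$ of a permutation $\alpha$ of $\{1,\ldots,n\}$ is the nonnegative integer defined by $n+1-2g(\alpha)=z(\alpha)+z(\alpha^{-1}\zeta_n)$. A permutation is called a partition if each of its cycles, listed beginning with its least element, is an increasing list; thus partitions correspond bijectively to set partitions of $\{1,\ldots,n\}$, the parts being the cycles. *)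

theory Defs
  imports
    "HOL-Combinatorics.Combinatorics"
    "HOL-Computational_Algebra.Computational_Algebra"
begin

section \<open>Genus of permutations and partitions\<close>

definition zeta :: "nat \<Rightarrow> nat \<Rightarrow> nat" where
  "zeta n = cycle_of_list [1..<Suc n]"

text \<open>The orbit of a fixed point is a singleton, so fixed points count as cycles.\<close>
definition num_cycles :: "nat \<Rightarrow> (nat \<Rightarrow> nat) \<Rightarrow> nat" where
  "num_cycles n \<alpha> = card (orbit \<alpha> ` {1..n})"

text \<open>The genus is the unique nonnegative integer satisfying this equation; it is
  rendered as a relation so that it does not presuppose existence. The equation
  is stated over the integers to avoid truncated subtraction.\<close>
definition has_genus :: "nat \<Rightarrow> (nat \<Rightarrow> nat) \<Rightarrow> nat \<Rightarrow> bool" where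
  "has_genus n \<alpha> g \<longleftrightarrow>
     int n + 1 - 2 * int g = int (num_cycles n \<alpha>) + int (num_cycles n (inv \<alpha> \<circ> zeta n))"

text \<open>\<open>support \<alpha> m\<close> is the list \<open>m, \<alpha> m, \<alpha> (\<alpha> m), \<dots>\<close> running once
  through the cycle of \<open>m\<close>.\<close>
definition is_partition :: "nat \<Rightarrow> (nat \<Rightarrow> nat) \<Rightarrow> bool" where
  "is_partition n \<alpha> \<longleftrightarrow> \<alpha> permutes {1..n} \<and>
     (\<forall>m\<in>{1..n}. m = Min (orbit \<alpha> m) \<longrightarrow> sorted_wrt (<) (support \<alpha> m))"

definition num_partitions :: "nat \<Rightarrow> nat \<Rightarrow> nat \<Rightarrow> nat" where
  "num_partitions g n k =
     card {\<alpha>. is_partition n \<alpha> \<and> has_genus n \<alpha> g \<and> num_cycles n \<alpha> = k}"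


section \<open>Formal power series in two variables\<close>

text \<open>The ring of formal power series in \<open>x\<close> and \<open>y\<close> is represented by \<open>real fps fps\<close>: the
  outer series variable is \<open>x\<close>, the inner one is \<open>y\<close>.\<close>

definition const2 :: "real \<Rightarrow> real fps fps" where
  "const2 c = fps_const (fps_const c)"

definition varx :: "real fps fps" where
  "varx = fps_X"

definition vary :: "real fps fps" where
  "vary = fps_const fps_X"

definition partition_gf :: "nat \<Rightarrow> real fps fps" where
  "partition_gf g = Abs_fps (\<lambda>n. Abs_fps (\<lambda>k.
     if n \<ge> 1 \<and> k \<ge> 1 then of_nat (num_partitions g n k) else 0))"

definition fps2_sqrt :: "real fps fps \<Rightarrow> real fps fps" where
  "fps2_sqrt D = (THE S. S ^ 2 = D \<and> S $ 0 $ 0 = 1)"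

text \<open>Whenever the coefficient of \<open>x ^ 0\<close> is the series 1, the square root with
  constant term 1 exists uniquely.\<close>
lemma fps2_sqrt_ex1:
  fixes D :: "real fps fps"
  assumes "D $ 0 = 1"
  shows "\<exists>!S. S ^ 2 = D \<and> S $ 0 $ 0 = 1"
proof (rule ex_ex1I)
  define B :: "real fps fps" where
    "B = Abs_fps (\<lambda>n. fps_const (fps_binomial (1/2) $ n))"
  have bb: "fps_binomial (1/2) * fps_binomial (1/2) = 1 + (fps_X :: real fps)"
    by (simp flip: fps_binomial_add_mult add: fps_binomial_1)
  have "B * B = 1 + fps_X"
  proof (rule fps_ext)
    fix n
    have "(B * B) $ n = fps_const ((fps_binomial (1/2) * fps_binomial (1/2)) $ n)"
      unfolding B_def fps_mult_nth fps_nth_Abs_fps fps_const_mult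
      by (rule fps_ext) (simp add: fps_sum_nth)
    also have "\<dots> = (1 + fps_X) $ n"
      unfolding bb by (simp add: fps_X_def)
    finally show "(B * B) $ n = (1 + fps_X) $ n" .
  qed
  moreover have "(D - 1) $ 0 = 0" using assms by simp
  ultimately have "(B oo (D - 1)) * (B oo (D - 1)) = D"
    using fps_compose_mult_distrib[of "D - 1" B B]
    by (simp add: fps_compose_add_distrib)
  moreover have "(B oo (D - 1)) $ 0 $ 0 = 1"
    by (simp add: B_def)
  ultimately show "\<exists>S. S ^ 2 = D \<and> S $ 0 $ 0 = 1"
    by (auto simp: power2_eq_square)
next
  fix S T :: "real fps fps"
  assume "S ^ 2 = D \<and> S $ 0 $ 0 = 1" "T ^ 2 = D \<and> T $ 0 $ 0 = 1"
  then have "S = T \<or> S = - T" "S $ 0 $ 0 = 1" "T $ 0 $ 0 = 1"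
    by (auto simp flip: power2_eq_iff)
  then show "S = T" by auto
qed

lemma fps2_sqrt_disc:
  defines "D \<equiv> (varx + varx * vary - 1) ^ 2 - 4 * varx ^ 2 * vary"
  shows "fps2_sqrt D ^ 2 = D" "fps2_sqrt D $ 0 $ 0 = 1"
proof -
  have "D $ 0 = 1"
    by (simp add: D_def varx_def vary_def power2_eq_square)
  from theI'[OF fps2_sqrt_ex1[OF this]]
  show "fps2_sqrt D ^ 2 = D" "fps2_sqrt D $ 0 $ 0 = 1"
    unfolding fps2_sqrt_def by auto
qed


section \<open>Polynomials and rational functions in several variables\<close>

text \<open>Polynomials in several variables are nested univariate polynomials; the innermost
  variable is the first argument.\<close>

definition eval1 :: "real poly \<Rightarrow> real fps fps \<Rightarrow> real fps fps" where
  "eval1 p u = poly (map_poly const2 p) u"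

definition eval2 :: "real poly poly \<Rightarrow> real fps fps \<Rightarrow> real fps fps \<Rightarrow> real fps fps" where
  "eval2 p u v = poly (map_poly (\<lambda>q. eval1 q u) p) v"

definition eval3 ::
  "real poly poly poly \<Rightarrow> real fps fps \<Rightarrow> real fps fps \<Rightarrow> real fps fps \<Rightarrow> real fps fps" where
  "eval3 p u v w = poly (map_poly (\<lambda>q. eval2 q u v) p) w"

text \<open>The field of rational functions in \<open>x\<close> and \<open>y\<close>, as a subfield of the fraction field of
  the ring of power series.\<close>
definition ratfuns_xy :: "real fps fps fract set" where
  "ratfuns_xy =
     {to_fract (eval2 A varx vary) / to_fract (eval2 B varx vary) | A B. B \<noteq> 0}"

definition algebraic_over :: "'a::field set \<Rightarrow> 'a \<Rightarrow> bool" where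
  "algebraic_over K z \<longleftrightarrow> (\<exists>p. (\<forall>i. coeff p i \<in> K) \<and> p \<noteq> 0 \<and> poly p z = 0)"

text \<open>The rational function \<open>F\<close> is defined at the power series \<open>u, v, w\<close>, meaning that
  some representation as a quotient has a denominator not vanishing there, and its value
  (an element of the fraction field) is \<open>z\<close>.\<close>
definition ratfun_has_value ::
  "real poly poly poly fract \<Rightarrow> real fps fps \<Rightarrow> real fps fps \<Rightarrow> real fps fps \<Rightarrow>
     real fps fps fract \<Rightarrow> bool" where
  "ratfun_has_value F u v w z \<longleftrightarrow>
     (\<exists>A B. F = Fract A B \<and> eval3 B u v w \<noteq> 0 \<and>
        z = to_fract (eval3 A u v w) / to_fract (eval3 B u v w))"

end

theory Submission
  imports Defs
begin

text \<open>
  Deleting a fixed point of \<open>\<alpha>\<close>, or a point \<open>i\<close> with \<open>\<alpha> i = i + 1\<close>, preserves the genus and the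
  property of being a partition. Inclusion--exclusion over the sets of deleted points expresses
  the generating function \<open>R(x, y)\<close> of the partitions without such points as
  \<open>P(x / ((1 + x) (1 + x y)), y) / (1 + x y)\<close>. The inverse substitution solves the quadratic
  equation \<open>\<xi> = x (1 + \<xi>) (1 + \<xi> y)\<close>, whose discriminant is \<open>(x + x y - 1)\<^sup>2 - 4 x\<^sup>2 y\<close>.
  A part \<open>{i, j}\<close> such that \<open>i + 1\<close> and \<open>j - 1\<close> are the least and the greatest element of
  another part can be deleted as well; this turns \<open>R\<close> into \<open>Q(x, y / (1 - x\<^sup>2 y))\<close>, where \<open>Q\<close>
  counts the partitions with nothing left to delete. By Euler's formula there are
  only finitely many of these for given genus, so \<open>Q\<close> is a polynomial.
\<close>

section \<open>Counting orbits under insertion of points\<close>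

text \<open>Deleting a fixed point may create a succession (a point \<open>i\<close> with
  \<open>\<alpha> i = i + 1\<close>), and deleting a succession may create a fixed point, so
  removing all of them one after another gives no direct count. Inclusion-exclusion needs only
  partitions with some such points marked, where exactly the marked points are deleted; inserting
  one marked point at a time is a bijection, and the resulting recursions have products of binomial
  coefficients as solutions, which are coefficients of powers of geometric series. Chords, the
  deletable parts \<open>{i, j}\<close>, do not interfere with each other: an insertion adds exactly
  one and keeps the others, so the exact number of chords can be tracked without signs. Chords have
  to be removed too because parallel 2-cycles can be stacked without changing the genus, so that
  even without fixed points and successions there may be infinitely many partitions left. Being a
  partition is expressed by numbers of weak descents and of cycles, since these are easy to follow
  through each insertion.\<close>

lemma orbit_eq_of_mem:
  assumes "permutation f" "s \<in> orbit f t"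
  shows "orbit f s = orbit f t"
  using orbit_cyclic_eq3[OF cyclic_on_orbit'[OF assms(1)] assms(2)] .

lemma orbit_pullback:
  assumes inj: "inj_on h B" and t: "t \<in> B"
    and closed: "\<And>t. t \<in> B \<Longrightarrow> \<tau> t \<in> B"
    and step: "\<And>t. t \<in> B \<Longrightarrow> h (\<tau> t) = f (h t) \<or> (f (h t) \<notin> h ` B \<and> h (\<tau> t) = f (f (h t)))"
  shows "orbit \<tau> t = {u \<in> B. h u \<in> orbit f (h t)}"
proof (intro set_eqI iffI)
  fix u assume "u \<in> orbit \<tau> t"
  then show "u \<in> {u \<in> B. h u \<in> orbit f (h t)}"
  proof induction
    case base
    have "f (h t) \<in> orbit f (h t)" "f (f (h t)) \<in> orbit f (h t)"
      by (simp_all add: orbit.intros)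
    with step[OF t] closed[OF t] show ?case by auto
  next
    case (step y)
    then have "y \<in> B" "h y \<in> orbit f (h t)" by auto
    then have "f (h y) \<in> orbit f (h t)" "f (f (h y)) \<in> orbit f (h t)"
      by (simp_all add: orbit.intros)
    with assms(4)[of y] closed[of y] \<open>y \<in> B\<close> show ?case by auto
  qed
next
  \<comment> \<open>Strong induction on the number of steps of \<open>f\<close>, since one step of
    \<open>\<tau>\<close> uses up one or two of them. The case where none remain is separate because
    \<open>orbit\<close> starts at the first iterate.\<close>
  have key: "u \<in> orbit \<tau> t" if "k > 0" "t \<in> B" "u \<in> B" "(f ^^ k) (h t) = h u" for k t u
    using that
  proof (induction k arbitrary: t rule: less_induct)
    case (less k)
    from step[OF less.prems(2)] show ?case
    proof (elim disjE conjE)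
      assume h: "h (\<tau> t) = f (h t)"
      obtain k' where k': "k = Suc k'" using less.prems(1) by (cases k) auto
      have eq: "(f ^^ k') (h (\<tau> t)) = h u"
        using less.prems(4) unfolding k' h by (simp add: funpow_swap1)
      show ?thesis
      proof (cases "k' = 0")
        case True
        with eq have "u = \<tau> t"
          using inj_onD[OF inj] less.prems closed by fastforce
        then show ?thesis by (simp add: orbit.base)
      next
        case False
        then have "u \<in> orbit \<tau> (\<tau> t)"
          using less.IH[of k' "\<tau> t"] eq closed less.prems k' by auto
        then show ?thesis by (rule orbit_subset)
      qed
    next
      assume h: "f (h t) \<notin> h ` B" "h (\<tau> t) = f (f (h t))"
      have "k \<noteq> 1" using h(1) less.prems by auto
      then obtain k' where k': "k = Suc (Suc k')"
        using less.prems(1) by (metis One_nat_def not0_implies_Suc not_gr0)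
      have eq: "(f ^^ k') (h (\<tau> t)) = h u"
        using less.prems(4) unfolding k' h by (simp add: funpow_swap1)
      show ?thesis
      proof (cases "k' = 0")
        case True
        with eq have "u = \<tau> t"
          using inj_onD[OF inj] less.prems closed by fastforce
        then show ?thesis by (simp add: orbit.base)
      next
        case False
        then have "u \<in> orbit \<tau> (\<tau> t)"
          using less.IH[of k' "\<tau> t"] eq closed less.prems k' by auto
        then show ?thesis by (rule orbit_subset)
      qed
    qed
  qed
  fix u assume "u \<in> {u \<in> B. h u \<in> orbit f (h t)}"
  then show "u \<in> orbit \<tau> t"
    using key[OF _ t] unfolding orbit_altdef[of f] by force
qed

text \<open>This settles all cycles through old points after an insertion. Whether a new point adds
  a cycle is then decided by \<open>card_orbits_insert_new\<close> and
  \<open>card_orbits_insert_old\<close>.\<close>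

lemma card_orbits_pullback:
  assumes "permutation f" and inj: "inj_on h B"
    and closed: "\<And>t. t \<in> B \<Longrightarrow> \<tau> t \<in> B"
    and step: "\<And>t. t \<in> B \<Longrightarrow> h (\<tau> t) = f (h t) \<or> (f (h t) \<notin> h ` B \<and> h (\<tau> t) = f (f (h t)))"
  shows "card (orbit \<tau> ` B) = card (orbit f ` h ` B)"
proof -
  define \<phi> where "\<phi> = (\<lambda>X. {u \<in> B. h u \<in> X})"
  have "orbit \<tau> ` B = \<phi> ` orbit f ` h ` B"
    using orbit_pullback[OF inj _ closed step] by (auto simp: \<phi>_def image_image)
  moreover have "inj_on \<phi> (orbit f ` h ` B)"
  proof (intro inj_onI; elim imageE; hypsubst)
    fix s t assume st: "s \<in> B" "t \<in> B" and eq: "\<phi> (orbit f (h s)) = \<phi> (orbit f (h t))"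
    have "s \<in> \<phi> (orbit f (h s))"
      using st permutation_self_in_orbit[OF assms(1)] by (simp add: \<phi>_def)
    then have "h s \<in> orbit f (h t)" unfolding eq by (simp add: \<phi>_def)
    then show "orbit f (h s) = orbit f (h t)" by (rule orbit_eq_of_mem[OF assms(1)])
  qed
  ultimately show ?thesis by (simp add: card_image)
qed

lemma orbit_two_cycle:
  assumes "f x = y" "f y = x"
  shows "orbit f x = {x, y}"
proof
  show "orbit f x \<subseteq> {x, y}"
  proof
    fix z assume "z \<in> orbit f x"
    then show "z \<in> {x, y}" by induction (use assms in auto)
  qed
  have "y \<in> orbit f x" "x \<in> orbit f x"
    using orbit.base[of f x] orbit.step[of "f x" f x] assms by simp_all
  then show "{x, y} \<subseteq> orbit f x" by simp
qed

lemma card_orbits_insert_new: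
  assumes f: "permutation f" and "finite A" and "\<And>y. y \<in> orbit f i \<Longrightarrow> y \<notin> A"
  shows "card (orbit f ` insert i A) = Suc (card (orbit f ` A))"
proof -
  have "orbit f i \<notin> orbit f ` A"
    using assms permutation_self_in_orbit[OF f] by (metis imageE)
  then show ?thesis using assms by simp
qed

lemma card_orbits_insert_old:
  assumes f: "permutation f" and "y \<in> orbit f i" "y \<in> A"
  shows "card (orbit f ` insert i A) = card (orbit f ` A)"
proof -
  have "orbit f i \<in> orbit f ` A"
    using assms orbit_eq_of_mem[OF f] by (metis imageI)
  then show ?thesis by (simp add: insert_absorb)
qed

section \<open>Relabelling and insertion of a fixed point\<close>

definition skip :: "nat \<Rightarrow> nat \<Rightarrow> nat" where
  "skip i t = (if t < i then t else Suc t)"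

definition unskip :: "nat \<Rightarrow> nat \<Rightarrow> nat" where
  "unskip i t = (if t < i then t else t - 1)"

definition insert_fixed :: "nat \<Rightarrow> (nat \<Rightarrow> nat) \<Rightarrow> nat \<Rightarrow> nat" where
  "insert_fixed i \<alpha> t = (if t = i then i else skip i (\<alpha> (unskip i t)))"

definition delete_fixed :: "nat \<Rightarrow> (nat \<Rightarrow> nat) \<Rightarrow> nat \<Rightarrow> nat" where
  "delete_fixed i \<alpha> t = unskip i (\<alpha> (skip i t))"

lemma unskip_skip [simp]: "unskip i (skip i t) = t"
  by (auto simp: skip_def unskip_def)

lemma skip_unskip: "t \<noteq> i \<Longrightarrow> skip i (unskip i t) = t"
  by (auto simp: skip_def unskip_def)

lemma skip_neq [simp]: "skip i t \<noteq> i" "i \<noteq> skip i t"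
  by (auto simp: skip_def)

lemma skip_eq_iff [simp]: "skip i s = skip i t \<longleftrightarrow> s = t"
  by (auto simp: skip_def)

lemma skip_le_iff [simp]: "skip i s \<le> skip i t \<longleftrightarrow> s \<le> t"
  by (auto simp: skip_def)

lemma skip_less_iff [simp]: "skip i s < skip i t \<longleftrightarrow> s < t"
  by (auto simp: skip_def)

lemma inj_skip: "inj (skip i)"
  by (simp add: inj_def)

lemma insert_fixed_self [simp]: "insert_fixed i \<alpha> i = i"
  by (simp add: insert_fixed_def)

lemma insert_fixed_skip [simp]: "insert_fixed i \<alpha> (skip i t) = skip i (\<alpha> t)"
  by (simp add: insert_fixed_def)

lemma interval_eq_skip:
  assumes "i \<le> Suc n" "a \<le> i"
  shows "{a..Suc n} = insert i (skip i ` {a..n})"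
proof (intro set_eqI iffI)
  fix x assume "x \<in> {a..Suc n}"
  then show "x \<in> insert i (skip i ` {a..n})"
    using assms skip_unskip[of x i]
    by (cases "x = i") (auto simp: unskip_def image_iff split: if_splits intro!: bexI[of _ "unskip i x"])
qed (use assms in \<open>auto simp: skip_def\<close>)

lemma nat_cases_skip: obtains "t = i" | u where "t = skip i u"
  using skip_unskip[of t i] by metis

lemma inv_insert_fixed:
  assumes "bij \<alpha>"
  shows "bij (insert_fixed i \<alpha>)" "inv (insert_fixed i \<alpha>) = insert_fixed i (inv \<alpha>)"
proof -
  have 1: "insert_fixed i (inv \<alpha>) (insert_fixed i \<alpha> t) = t" for t
    using assms by (cases t rule: nat_cases_skip[of _ i]) (auto simp: bij_is_inj)
  have 2: "insert_fixed i \<alpha> (insert_fixed i (inv \<alpha>) t) = t" for t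
    using assms by (cases t rule: nat_cases_skip[of _ i]) (auto simp: bij_is_surj surj_f_inv_f)
  show "bij (insert_fixed i \<alpha>)"
    using 1 2 by (metis bijI' )
  show "inv (insert_fixed i \<alpha>) = insert_fixed i (inv \<alpha>)"
    using 1 2 by (intro inv_equality) auto
qed

lemma insert_fixed_permutes:
  assumes "\<alpha> permutes {1..n}" "1 \<le> i" "i \<le> Suc n"
  shows "insert_fixed i \<alpha> permutes {1..Suc n}"
  unfolding permutes_def
proof (intro conjI allI impI)
  fix t assume t: "t \<notin> {1..Suc n}"
  have "t \<noteq> i" using t assms by auto
  then obtain u where u: "t = skip i u" using skip_unskip by metis
  then have "u \<notin> {1..n}"
    using interval_eq_skip[OF assms(3,2)] t by blast
  with u show "insert_fixed i \<alpha> t = t" using permutes_not_in[OF assms(1)] by simp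
next
  fix y
  show "\<exists>!x. insert_fixed i \<alpha> x = y"
    using inv_insert_fixed(1)[OF permutes_bij[OF assms(1)]] by (metis bij_pointE)
qed

lemma delete_fixed_insert_fixed [simp]: "delete_fixed i (insert_fixed i \<alpha>) = \<alpha>"
  by (rule ext) (simp add: delete_fixed_def)

lemma insert_fixed_delete_fixed:
  assumes "inj \<alpha>" "\<alpha> i = i"
  shows "insert_fixed i (delete_fixed i \<alpha>) = \<alpha>"
proof
  fix t show "insert_fixed i (delete_fixed i \<alpha>) t = \<alpha> t"
  proof (cases t rule: nat_cases_skip[of _ i])
    case (2 u)
    then have "\<alpha> t \<noteq> i" using assms by (metis injD skip_neq(1))
    with 2 show ?thesis by (simp add: delete_fixed_def skip_unskip)
  qed (use assms in simp)
qed

lemma delete_fixed_permutes: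
  assumes "\<alpha> permutes {1..Suc n}" "\<alpha> i = i" "1 \<le> i" "i \<le> Suc n"
  shows "delete_fixed i \<alpha> permutes {1..n}"
  unfolding permutes_def
proof (intro conjI allI impI)
  fix t assume t: "t \<notin> {1..n}"
  then have "skip i t \<notin> {1..Suc n}"
    unfolding interval_eq_skip[OF assms(4,3)] by auto
  then show "delete_fixed i \<alpha> t = t"
    using permutes_not_in[OF assms(1)] by (simp add: delete_fixed_def)
next
  fix y
  have inj: "inj \<alpha>" using permutes_inj[OF assms(1)] .
  have ne: "\<alpha> (skip i x) \<noteq> i" for x using inj assms(2) by (metis injD skip_neq(1))
  obtain x where x: "\<alpha> x = skip i y" using permutes_surj[OF assms(1)] by (metis surjD)
  then obtain z where z: "x = skip i z" using assms(2) by (cases x rule: nat_cases_skip[of _ i]) auto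
  show "\<exists>!x. delete_fixed i \<alpha> x = y"
  proof (rule ex1I)
    show "delete_fixed i \<alpha> z = y" using x z by (simp add: delete_fixed_def)
    fix w assume "delete_fixed i \<alpha> w = y"
    then have "\<alpha> (skip i w) = skip i y" using ne skip_unskip by (metis delete_fixed_def)
    then have "skip i w = skip i z" using x z inj by (metis injD)
    then show "w = z" by simp
  qed
qed

section \<open>The long cycle and the face permutation\<close>

definition rot :: "nat \<Rightarrow> nat \<Rightarrow> nat" where
  "rot n t = (if t < n then Suc t else if t = n then 0 else t)"

lemma rot_permutes: "rot n permutes {0..n}"
  unfolding permutes_def
proof (intro conjI allI impI)
  fix y
  show "\<exists>!x. rot n x = y"
    by (rule ex1I[of _ "if y = 0 then n else if y \<le> n then y - 1 else y"])
      (auto simp: rot_def split: if_splits)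
qed (auto simp: rot_def)

lemma rot_skip:
  assumes "1 \<le> i" "i \<le> Suc n"
  shows "rot (Suc n) (skip i t) = (if Suc t = i then i else skip i (rot n t))"
  using assms by (auto simp: rot_def skip_def)

lemma rot_self:
  assumes "1 \<le> i" "i \<le> Suc n"
  shows "rot (Suc n) i = skip i (rot n (i - 1))"
  using assms by (auto simp: rot_def skip_def)

text \<open>The extra point 0, fixed by \<open>\<alpha>\<close>, does not change the number of cycles for \<open>n \<ge> 1\<close>; it gives
  the right value 1 for \<open>n = 0\<close> and keeps insertions away from the point where the rotation wraps.\<close>
definition faces :: "nat \<Rightarrow> (nat \<Rightarrow> nat) \<Rightarrow> nat" where
  "faces n \<alpha> = card (orbit (inv \<alpha> \<circ> rot n) ` {0..n})"

lemma face_perm: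
  assumes "\<alpha> permutes {1..n}"
  shows "inv \<alpha> \<circ> rot n permutes {0..n}"
  by (rule permutes_compose[OF rot_permutes])
    (rule permutes_subset[OF permutes_inv[OF assms]], auto)

lemma permutes_permutation: "f permutes {a..b::nat} \<Longrightarrow> permutation f"
  using permutation_permutes by blast

definition descents :: "nat \<Rightarrow> (nat \<Rightarrow> nat) \<Rightarrow> nat set" where
  "descents n \<alpha> = {t \<in> {1..n}. \<alpha> t \<le> t}"

context
  fixes \<alpha> :: "nat \<Rightarrow> nat" and n i :: nat
  assumes perm: "\<alpha> permutes {1..n}" and i: "1 \<le> i" "i \<le> Suc n"
begin

lemma num_cycles_insert_fixed: "num_cycles (Suc n) (insert_fixed i \<alpha>) = Suc (num_cycles n \<alpha>)"
proof -
  have p: "permutation (insert_fixed i \<alpha>)"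
    using insert_fixed_permutes[OF perm i] by (rule permutes_permutation)
  have "card (orbit \<alpha> ` {1..n}) = card (orbit (insert_fixed i \<alpha>) ` skip i ` {1..n})"
    using permutes_in_image[OF perm]
    by (intro card_orbits_pullback p inj_on_subset[OF inj_skip]) auto
  moreover have "orbit (insert_fixed i \<alpha>) i = {i}"
    by (simp add: orbit_eq_singleton_iff)
  then have "card (orbit (insert_fixed i \<alpha>) ` insert i (skip i ` {1..n})) =
      Suc (card (orbit (insert_fixed i \<alpha>) ` skip i ` {1..n}))"
    by (intro card_orbits_insert_new p) auto
  ultimately show ?thesis
    unfolding num_cycles_def interval_eq_skip[OF i(2,1)] by simp
qed

text \<open>The new point lies on the old face cycle of \<open>i - 1\<close>, directly after that
  point, so no face is created.\<close>

lemma faces_insert_fixed: "faces (Suc n) (insert_fixed i \<alpha>) = faces n \<alpha>"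
proof -
  define f where "f = inv (insert_fixed i \<alpha>) \<circ> rot (Suc n)"
  have f_alt: "f = insert_fixed i (inv \<alpha>) \<circ> rot (Suc n)"
    unfolding f_def by (simp add: inv_insert_fixed permutes_bij[OF perm])
  have p: "permutation f"
    unfolding f_def using face_perm[OF insert_fixed_permutes[OF perm i]] by (rule permutes_permutation)
  have fi: "f i = skip i ((inv \<alpha> \<circ> rot n) (i - 1))"
    unfolding f_alt by (simp add: rot_self[OF i])
  have st: "skip i ((inv \<alpha> \<circ> rot n) t) = f (skip i t) \<or>
      f (skip i t) \<notin> skip i ` {0..n} \<and> skip i ((inv \<alpha> \<circ> rot n) t) = f (f (skip i t))" for t
  proof (cases "Suc t = i")
    case True
    then have "f (skip i t) = i" unfolding f_alt by (simp add: rot_skip[OF i])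
    then show ?thesis using fi True by auto
  next
    case False
    then have "f (skip i t) = skip i ((inv \<alpha> \<circ> rot n) t)"
      unfolding f_alt by (simp add: rot_skip[OF i])
    then show ?thesis by simp
  qed
  have "card (orbit (inv \<alpha> \<circ> rot n) ` {0..n}) = card (orbit f ` skip i ` {0..n})"
    using permutes_in_image[OF face_perm[OF perm]] st
    by (intro card_orbits_pullback p inj_on_subset[OF inj_skip]) auto
  also have "\<dots> = card (orbit f ` insert i (skip i ` {0..n}))"
  proof (intro card_orbits_insert_old[symmetric, OF p])
    show "f i \<in> orbit f i" by (rule orbit.base)
    have "i - 1 \<in> {0..n}" using i by auto
    then show "f i \<in> skip i ` {0..n}"
      unfolding fi using permutes_in_image[OF face_perm[OF perm]] by blast
  qed
  finally show ?thesis
    unfolding faces_def f_def[symmetric] using interval_eq_skip[OF i(2), of 0] by simp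
qed

lemma descents_insert_fixed: "descents (Suc n) (insert_fixed i \<alpha>) = insert i (skip i ` descents n \<alpha>)"
  unfolding descents_def interval_eq_skip[OF i(2,1)] by auto

end

section \<open>Insertion of a succession\<close>

definition insert_succ :: "nat \<Rightarrow> (nat \<Rightarrow> nat) \<Rightarrow> nat \<Rightarrow> nat" where
  "insert_succ i \<alpha> = transpose i (Suc i) \<circ> insert_fixed i \<alpha>"

text \<open>Two new fixed points joined to a 2-cycle. It is applied with
  \<open>i = \<alpha> a\<close> and \<open>j = a + 2\<close> for a weak descent \<open>a\<close>, so
  that the 2-cycle closely encloses the step from \<open>a\<close> to
  \<open>\<alpha> a\<close>.\<close>

definition insert_chord :: "nat \<Rightarrow> nat \<Rightarrow> (nat \<Rightarrow> nat) \<Rightarrow> nat \<Rightarrow> nat" where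
  "insert_chord i j \<alpha> = transpose i j \<circ> insert_fixed j (insert_fixed i \<alpha>)"

definition fixed_points :: "nat \<Rightarrow> (nat \<Rightarrow> nat) \<Rightarrow> nat set" where
  "fixed_points n \<alpha> = {t \<in> {1..n}. \<alpha> t = t}"

definition successions :: "nat \<Rightarrow> (nat \<Rightarrow> nat) \<Rightarrow> nat set" where
  "successions n \<alpha> = {t \<in> {1..n}. \<alpha> t = Suc t}"

lemma fixed_points_insert_fixed:
  assumes "1 \<le> i" "i \<le> Suc n"
  shows "fixed_points (Suc n) (insert_fixed i \<alpha>) = insert i (skip i ` fixed_points n \<alpha>)"
  unfolding fixed_points_def interval_eq_skip[OF assms(2,1)] by auto

lemma skip_self [simp]: "skip i i = Suc i"
  by (simp add: skip_def)

lemma insert_succ_self [simp]: "insert_succ i \<alpha> i = Suc i"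
  by (simp add: insert_succ_def)

text \<open>Only the step into the old point \<open>i\<close> is rerouted: it now enters the new
  point, which leads on to the old one, relabelled \<open>i + 1\<close>.\<close>

lemma insert_succ_skip:
  "insert_succ i \<alpha> (skip i t) = (if \<alpha> t = i then i else skip i (\<alpha> t))"
proof (cases "\<alpha> t = i")
  case False
  then have "skip i (\<alpha> t) \<noteq> Suc i" by (auto simp: skip_def)
  then show ?thesis by (simp add: insert_succ_def False transpose_def)
qed (simp add: insert_succ_def)

context
  fixes \<alpha> :: "nat \<Rightarrow> nat" and n i :: nat
  assumes perm: "\<alpha> permutes {1..n}" and i: "1 \<le> i" "i \<le> n"
begin

lemma insert_succ_permutes: "insert_succ i \<alpha> permutes {1..Suc n}"
  unfolding insert_succ_def using i
  by (intro permutes_compose[OF insert_fixed_permutes[OF perm]] permutes_swap_id) auto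

lemma num_cycles_insert_succ: "num_cycles (Suc n) (insert_succ i \<alpha>) = num_cycles n \<alpha>"
proof -
  have p: "permutation (insert_succ i \<alpha>)"
    using insert_succ_permutes by (rule permutes_permutation)
  have st: "skip i (\<alpha> t) = insert_succ i \<alpha> (skip i t) \<or>
      insert_succ i \<alpha> (skip i t) \<notin> skip i ` {1..n} \<and>
      skip i (\<alpha> t) = insert_succ i \<alpha> (insert_succ i \<alpha> (skip i t))" for t
    by (auto simp: insert_succ_skip split: if_splits)
  have "card (orbit \<alpha> ` {1..n}) = card (orbit (insert_succ i \<alpha>) ` skip i ` {1..n})"
    using permutes_in_image[OF perm] st
    by (intro card_orbits_pullback p inj_on_subset[OF inj_skip]) auto
  also have "\<dots> = card (orbit (insert_succ i \<alpha>) ` insert i (skip i ` {1..n}))"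
  proof (intro card_orbits_insert_old[symmetric, OF p])
    show "Suc i \<in> orbit (insert_succ i \<alpha>) i"
      using orbit.base[of "insert_succ i \<alpha>" i] by simp
    show "Suc i \<in> skip i ` {1..n}"
      using i by (intro image_eqI[of _ _ i]) auto
  qed
  finally show ?thesis
    unfolding num_cycles_def using interval_eq_skip[of i n 1] i by simp
qed

text \<open>\<open>rot\<close> and \<open>\<alpha>\<close> agree at a succession, so the new point
  is fixed by the face permutation and forms a face of its own.\<close>

lemma faces_insert_succ: "faces (Suc n) (insert_succ i \<alpha>) = Suc (faces n \<alpha>)"
proof -
  have i': "1 \<le> i" "i \<le> Suc n" using i by auto
  have b: "bij \<alpha>" using permutes_bij[OF perm] .
  define f where "f = inv (insert_succ i \<alpha>) \<circ> rot (Suc n)"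
  have f_alt: "f = insert_fixed i (inv \<alpha>) \<circ> transpose i (Suc i) \<circ> rot (Suc n)"
    unfolding f_def insert_succ_def
    by (subst o_inv_distrib) (auto simp: inv_insert_fixed b comp_assoc)
  have p: "permutation f"
    unfolding f_def using face_perm[OF insert_succ_permutes] by (rule permutes_permutation)
  have fi: "f i = i"
    unfolding f_alt using i by (simp add: rot_def)
  have st: "skip i ((inv \<alpha> \<circ> rot n) t) = f (skip i t)" for t
  proof (cases "Suc t = i")
    case True
    then have "f (skip i t) = insert_fixed i (inv \<alpha>) (skip i i)"
      unfolding f_alt by (simp add: rot_skip[OF i'])
    moreover have "rot n t = i" using True i by (simp add: rot_def)
    ultimately show ?thesis by (simp del: skip_self)
  next
    case False
    then have "rot n t \<noteq> i" using i by (auto simp: rot_def)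
    then have "skip i (rot n t) \<noteq> Suc i" by (auto simp: skip_def)
    then show ?thesis
      unfolding f_alt using False by (simp add: rot_skip[OF i'] transpose_def)
  qed
  have "card (orbit (inv \<alpha> \<circ> rot n) ` {0..n}) = card (orbit f ` skip i ` {0..n})"
    using permutes_in_image[OF face_perm[OF perm]] st
    by (intro card_orbits_pullback p inj_on_subset[OF inj_skip]) auto
  moreover have "orbit f i = {i}"
    by (simp add: orbit_eq_singleton_iff fi)
  then have "card (orbit f ` insert i (skip i ` {0..n})) = Suc (card (orbit f ` skip i ` {0..n}))"
    by (intro card_orbits_insert_new p) auto
  ultimately show ?thesis
    unfolding faces_def f_def[symmetric] using interval_eq_skip[OF i'(2), of 0] by simp
qed

lemma descents_insert_succ: "descents (Suc n) (insert_succ i \<alpha>) = skip i ` descents n \<alpha>"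
proof -
  have "insert_succ i \<alpha> (skip i t) \<le> skip i t \<longleftrightarrow> \<alpha> t \<le> t" for t
    by (auto simp: insert_succ_skip) (auto simp: skip_def split: if_splits)
  then show ?thesis
    unfolding descents_def using interval_eq_skip[of i n 1] i by auto
qed

text \<open>A fixed point \<open>i\<close> is lost because it is extended to the 2-cycle of
  \<open>i\<close> and \<open>i + 1\<close>.\<close>

lemma fixed_points_insert_succ:
  "fixed_points (Suc n) (insert_succ i \<alpha>) = skip i ` (fixed_points n \<alpha> - {i})"
  unfolding fixed_points_def using interval_eq_skip[of i n 1] i
  by (auto simp: insert_succ_skip split: if_splits)

text \<open>No succession is lost, not even one that steps into the old point \<open>i\<close>: with
  the new point in between it becomes two successions in a row.\<close>

lemma successions_insert_succ:
  "successions (Suc n) (insert_succ i \<alpha>) = insert i (skip i ` successions n \<alpha>)"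
proof -
  have "insert_succ i \<alpha> (skip i t) = Suc (skip i t) \<longleftrightarrow> \<alpha> t = Suc t" for t
    by (auto simp: insert_succ_skip) (auto simp: skip_def split: if_splits)
  then show ?thesis
    unfolding successions_def using interval_eq_skip[of i n 1] i by auto
qed

end

section \<open>Insertion of a chord around a weak descent\<close>

definition embed :: "nat \<Rightarrow> nat \<Rightarrow> nat \<Rightarrow> nat" where
  "embed b a t = (if t < b then t else if t \<le> a then Suc t else Suc (Suc t))"

lemma embed_eq_skip: "b \<le> a \<Longrightarrow> skip (Suc (Suc a)) (skip b t) = embed b a t"
  by (auto simp: embed_def skip_def)

lemma embed_simps [simp]:
  assumes "b \<le> a"
  shows "embed b a s = embed b a t \<longleftrightarrow> s = t" "embed b a s \<le> embed b a t \<longleftrightarrow> s \<le> t"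
    "embed b a s < embed b a t \<longleftrightarrow> s < t"
    "embed b a t \<noteq> b" "embed b a t \<noteq> Suc (Suc a)" "b \<noteq> embed b a t" "Suc (Suc a) \<noteq> embed b a t"
  using assms by (auto simp: embed_def)

lemma inj_embed: "b \<le> a \<Longrightarrow> inj (embed b a)"
  by (simp add: inj_def)

lemma interval_eq_embed:
  assumes "b \<le> a" "c \<le> b" "a \<le> n"
  shows "{c..Suc (Suc n)} = insert b (insert (Suc (Suc a)) (embed b a ` {c..n}))"
proof -
  have "{c..Suc (Suc n)} = insert (Suc (Suc a)) (skip (Suc (Suc a)) ` insert b (skip b ` {c..n}))"
    using assms interval_eq_skip[of b n c] interval_eq_skip[of "Suc (Suc a)" "Suc n" c] by simp
  also have "\<dots> = insert b (insert (Suc (Suc a)) (embed b a ` {c..n}))"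
    using assms by (simp add: image_image embed_eq_skip) (auto simp: skip_def)
  finally show ?thesis .
qed

lemma insert_chord_simps:
  assumes "b \<le> a"
  shows "insert_chord b (Suc (Suc a)) \<alpha> b = Suc (Suc a)"
    "insert_chord b (Suc (Suc a)) \<alpha> (Suc (Suc a)) = b"
    "insert_chord b (Suc (Suc a)) \<alpha> (embed b a t) = embed b a (\<alpha> t)"
proof -
  have "skip (Suc (Suc a)) b = b" using assms by (simp add: skip_def)
  then have "insert_fixed (Suc (Suc a)) (insert_fixed b \<alpha>) b = b"
    by (metis insert_fixed_skip insert_fixed_self)
  then show "insert_chord b (Suc (Suc a)) \<alpha> b = Suc (Suc a)"
    by (simp add: insert_chord_def)
  show "insert_chord b (Suc (Suc a)) \<alpha> (Suc (Suc a)) = b"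
    by (simp add: insert_chord_def)
  have "insert_fixed (Suc (Suc a)) (insert_fixed b \<alpha>) (embed b a t) = embed b a (\<alpha> t)"
    using assms by (simp flip: embed_eq_skip)
  then show "insert_chord b (Suc (Suc a)) \<alpha> (embed b a t) = embed b a (\<alpha> t)"
    using assms by (simp add: insert_chord_def transpose_def)
qed

text \<open>Without fixed points and successions, \<open>\<alpha> i - 1\<close> is a weak descent
  with image \<open>i + 1\<close>. In a partition each part has just one weak descent, from its
  greatest to its least element, so this is the condition on the neighbouring part in the
  overview.\<close>

definition chords :: "nat \<Rightarrow> (nat \<Rightarrow> nat) \<Rightarrow> nat set" where
  "chords n \<alpha> = {i \<in> {1..n}. i < \<alpha> i \<and> \<alpha> (\<alpha> i) = i \<and> \<alpha> (\<alpha> i - 1) = Suc i}"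

context
  fixes \<alpha> :: "nat \<Rightarrow> nat" and n a b :: nat and \<beta>
  assumes perm: "\<alpha> permutes {1..n}" and ab: "1 \<le> b" "b \<le> a" "a \<le> n" "\<alpha> a = b"
  defines "\<beta> \<equiv> insert_chord b (Suc (Suc a)) \<alpha>"
begin

lemma insert_chord_permutes: "\<beta> permutes {1..Suc (Suc n)}"
  unfolding insert_chord_def \<beta>_def using ab
  by (intro permutes_compose[OF insert_fixed_permutes[OF insert_fixed_permutes[OF perm]]]
        permutes_swap_id) auto

lemma chord_interval: "{1..Suc (Suc n)} = insert b (insert (Suc (Suc a)) (embed b a ` {1..n}))"
  by (rule interval_eq_embed) (use ab in auto)

lemmas \<beta>_simps = insert_chord_simps[OF ab(2), of \<alpha>, folded \<beta>_def]

lemma num_cycles_insert_chord: "num_cycles (Suc (Suc n)) \<beta> = Suc (num_cycles n \<alpha>)"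
proof -
  have p: "permutation \<beta>"
    using insert_chord_permutes by (rule permutes_permutation)
  have "card (orbit \<alpha> ` {1..n}) = card (orbit \<beta> ` embed b a ` {1..n})"
    using permutes_in_image[OF perm] ab
    by (intro card_orbits_pullback p inj_on_subset[OF inj_embed]) (auto simp: \<beta>_simps)
  moreover have "orbit \<beta> b = {b, Suc (Suc a)}" "orbit \<beta> (Suc (Suc a)) = {b, Suc (Suc a)}"
    using orbit_two_cycle[of \<beta>] by (auto simp: \<beta>_simps)
  then have "card (orbit \<beta> ` insert b (insert (Suc (Suc a)) (embed b a ` {1..n})))
      = Suc (card (orbit \<beta> ` embed b a ` {1..n}))"
    using ab by (subst card_orbits_insert_old[OF p, of "Suc (Suc a)"], simp, simp,
        intro card_orbits_insert_new[OF p]) auto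
  ultimately show ?thesis unfolding num_cycles_def chord_interval by simp
qed

lemma faces_insert_chord: "faces (Suc (Suc n)) \<beta> = Suc (faces n \<alpha>)"
proof -
  \<comment> \<open>The 2-cycle that the chord adds to the face permutation is \<open>(b, a + 1)\<close>, not the chord
    \<open>(b, a + 2)\<close>, so the other points are placed by \<open>h\<close> instead of \<^term>\<open>embed b a\<close>.\<close>
  define h where "h t = (if t < b then t else if t < a then Suc t else Suc (Suc t))" for t
  have bj: "bij \<alpha>" using permutes_bij[OF perm] .
  define f where "f = inv \<beta> \<circ> rot (Suc (Suc n))"
  have inv\<beta>: "inv \<beta> x = y" if "\<beta> y = x" for x y
    using that permutes_inverses(2)[OF insert_chord_permutes] by blast
  have p: "permutation f"
    unfolding f_def using face_perm[OF insert_chord_permutes] by (rule permutes_permutation)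
  have inv_emb: "inv \<beta> (embed b a t) = embed b a (inv \<alpha> t)" for t
    by (rule inv\<beta>) (simp add: \<beta>_simps permutes_inverses[OF perm])
  have f1: "f b = Suc a"
  proof -
    have "embed b a b = Suc b" "embed b a a = Suc a" using ab by (auto simp: embed_def)
    then show ?thesis unfolding f_def
      using ab by (auto simp: rot_def intro!: inv\<beta>) (metis \<beta>_simps(3))
  qed
  have f2: "f (Suc a) = b"
  proof -
    have "rot (Suc (Suc n)) (Suc a) = Suc (Suc a)" using ab by (simp add: rot_def)
    then show ?thesis unfolding f_def using inv\<beta>[OF \<beta>_simps(1)] by simp
  qed
  \<comment> \<open>Only \<open>b - 1\<close> behaves in a new way: \<open>rot\<close> takes it to
    the new point \<open>b\<close>, and \<open>inv \<beta>\<close> from there to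
    \<open>a + 2\<close>, which is \<open>h a\<close>.\<close>
  have st: "h ((inv \<alpha> \<circ> rot n) t) = f (h t)" if "t \<le> n" for t
  proof (cases "rot n t = b")
    case True
    then have "Suc t = b" using ab that by (auto simp: rot_def split: if_splits)
    then have "rot (Suc (Suc n)) (h t) = b"
      using ab by (auto simp: rot_def h_def)
    then have "f (h t) = Suc (Suc a)" unfolding f_def by (auto simp: \<beta>_simps intro!: inv\<beta>)
    moreover have "inv \<alpha> (rot n t) = a" using True ab permutes_inverses(2)[OF perm] by metis
    ultimately show ?thesis using ab by (simp add: h_def)
  next
    case False
    then have "rot (Suc (Suc n)) (h t) = embed b a (rot n t)"
      using ab that by (auto simp: rot_def h_def embed_def split: if_splits)
    then have "f (h t) = embed b a (inv \<alpha> (rot n t))" unfolding f_def by (simp add: inv_emb)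
    moreover have "inv \<alpha> (rot n t) \<noteq> a" using False ab permutes_inverses(1)[OF perm] by metis
    ultimately show ?thesis by (auto simp add: h_def embed_def)
  qed
  have inj_h: "inj_on h {0..n}" by (auto simp: h_def inj_on_def split: if_splits)
  have "card (orbit (inv \<alpha> \<circ> rot n) ` {0..n}) = card (orbit f ` h ` {0..n})"
    using permutes_in_image[OF face_perm[OF perm]] st
    by (intro card_orbits_pullback p inj_h) auto
  moreover have "orbit f b = {b, Suc a}" "orbit f (Suc a) = {b, Suc a}"
    using orbit_two_cycle[of f] by (auto simp: f1 f2)
  then have "card (orbit f ` insert b (insert (Suc a) (h ` {0..n})))
      = Suc (card (orbit f ` h ` {0..n}))"
    using ab by (subst card_orbits_insert_old[OF p, of "Suc a"], simp, simp,
        intro card_orbits_insert_new[OF p]) (auto simp: h_def split: if_splits)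
  moreover have "{0..Suc (Suc n)} = insert b (insert (Suc a) (h ` {0..n}))"
  proof (intro set_eqI iffI)
    fix x assume x: "x \<in> {0..Suc (Suc n)}"
    consider "x < b" | "x = b" | "b < x" "x \<le> a" | "x = Suc a" | "Suc a < x" by linarith
    then show "x \<in> insert b (insert (Suc a) (h ` {0..n}))"
    proof cases
      case 1 then show ?thesis using ab by (auto simp: h_def intro!: image_eqI[of _ _ x])
    next
      case 3 then show ?thesis using ab by (auto simp: h_def intro!: image_eqI[of _ _ "x - 1"])
    next
      case 5 then show ?thesis using ab x by (auto simp: h_def intro!: image_eqI[of _ _ "x - 2"])
    qed auto
  qed (use ab in \<open>auto simp: h_def\<close>)
  ultimately show ?thesis
    unfolding faces_def f_def[symmetric] by simp
qed

lemma descents_insert_chord: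
  "descents (Suc (Suc n)) \<beta> = insert (Suc (Suc a)) (embed b a ` descents n \<alpha>)"
  unfolding descents_def chord_interval using ab(1-3) by (auto simp: \<beta>_simps)

lemma fixed_points_insert_chord:
  "fixed_points (Suc (Suc n)) \<beta> = embed b a ` fixed_points n \<alpha>"
  unfolding fixed_points_def chord_interval using ab(1-3) by (auto simp: \<beta>_simps)

text \<open>A succession could break only if a new label separated its two points, and one could
  arise only at the step from \<open>a\<close> to \<open>b\<close>. Neither happens, because
  \<open>a\<close> is the only point with image \<open>b\<close> and
  \<open>b \<le> a\<close>.\<close>

lemma successions_insert_chord:
  "successions (Suc (Suc n)) \<beta> = embed b a ` successions n \<alpha>"
proof -
  have inj: "\<alpha> x = \<alpha> y \<longleftrightarrow> x = y" for x y using permutes_inj[OF perm] by (simp add: inj_eq)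
  have "embed b a (\<alpha> t) = Suc (embed b a t) \<longleftrightarrow> \<alpha> t = Suc t" for t
  proof (cases "t = a \<or> \<alpha> t = b")
    case True
    then have "t = a" using inj ab by metis
    then show ?thesis using ab by (auto simp: embed_def)
  qed (use ab in \<open>auto simp: embed_def\<close>)
  then have "\<beta> (embed b a t) = Suc (embed b a t) \<longleftrightarrow> \<alpha> t = Suc t" for t
    by (simp add: \<beta>_simps)
  then show ?thesis
    unfolding successions_def chord_interval using ab(1-3) by (auto simp: \<beta>_simps(1,2))
qed

text \<open>The new chord is parallel to the step from \<open>a\<close> to \<open>b\<close>. A chord
  that was parallel to this step before remains one, being now parallel to the new chord; this is
  how stacks of chords arise.\<close>

lemma chords_insert_chord:
  "chords (Suc (Suc n)) \<beta> = insert b (embed b a ` chords n \<alpha>)"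
proof -
  have inj: "\<alpha> x = \<alpha> y \<longleftrightarrow> x = y" for x y using permutes_inj[OF perm] by (simp add: inj_eq)
  have e: "embed b a a = Suc a" "embed b a b = Suc b" using ab by (auto simp: embed_def)
  have "\<beta> (\<beta> b - 1) = Suc b" using e ab by (metis \<beta>_simps(1,3) diff_Suc_1)
  then have 1: "b \<in> chords (Suc (Suc n)) \<beta>" using ab(1-3) by (auto simp: chords_def \<beta>_simps)
  have 2: "Suc (Suc a) \<notin> chords (Suc (Suc n)) \<beta>" using ab(1-3) by (auto simp: chords_def \<beta>_simps)
  have 3: "\<beta> (embed b a v - 1) = Suc (embed b a u) \<longleftrightarrow> \<alpha> (v - 1) = Suc u"
    if uv: "u < v" "\<alpha> u = v" for u v
  proof -
    have "v \<noteq> b" using uv ab inj[of u a] by auto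
    have "u \<noteq> a" using uv ab by auto
    show ?thesis
    proof (cases "v = Suc a")
      \<comment> \<open>The old chord ends right after \<open>a\<close>. The label before its
        greater end is now \<open>a + 2\<close>, whose image is \<open>b\<close>, as the image of
        \<open>a\<close> was before.\<close>
      case True
      then have "embed b a v - 1 = Suc (Suc a)" using ab by (auto simp: embed_def)
      then have "\<beta> (embed b a v - 1) = b" by (simp add: \<beta>_simps)
      moreover have "b = Suc (embed b a u) \<longleftrightarrow> b = Suc u"
        by (auto simp: embed_def)
      ultimately show ?thesis using ab True by simp
    next
      case False
      then have "embed b a v - 1 = embed b a (v - 1)"
        using \<open>v \<noteq> b\<close> uv ab by (auto simp: embed_def)
      then have *: "\<beta> (embed b a v - 1) = embed b a (\<alpha> (v - 1))" by (simp add: \<beta>_simps)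
      show ?thesis
      proof (cases "Suc u = b")
        case True
        then have "Suc (embed b a u) = b" by (auto simp: embed_def)
        moreover have "\<alpha> (v - 1) \<noteq> b" using inj[of "v - 1" a] False ab uv by auto
        ultimately show ?thesis using * True ab by auto
      next
        case False
        then have "Suc (embed b a u) = embed b a (Suc u)"
          using \<open>u \<noteq> a\<close> by (auto simp: embed_def)
        then show ?thesis using * ab by simp
      qed
    qed
  qed
  have "embed b a u \<in> chords (Suc (Suc n)) \<beta> \<longleftrightarrow> u \<in> chords n \<alpha>" if "u \<in> {1..n}" for u
  proof -
    have "embed b a u \<in> {1..Suc (Suc n)}" using that chord_interval by blast
    then show ?thesis
      using that ab(1-3) 3[of u "\<alpha> u"] by (auto simp: chords_def \<beta>_simps)
  qed
  moreover have "chords (Suc (Suc n)) \<beta> \<subseteq> {1..Suc (Suc n)}" "chords n \<alpha> \<subseteq> {1..n}"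
    by (auto simp: chords_def)
  ultimately show ?thesis
    using 1 2 unfolding chord_interval by blast
qed

end

section \<open>Recursions for partitions of fixed genus\<close>

text \<open>Every cycle has a weak descent, and exactly one iff it is increasing when listed from its
  least element; hence equality of the first two statistics says that \<open>\<alpha>\<close> is a partition.\<close>
definition genus_class :: "nat \<Rightarrow> nat \<Rightarrow> nat \<Rightarrow> (nat \<Rightarrow> nat) set" where
  "genus_class g n k = {\<alpha>. \<alpha> permutes {1..n} \<and> card (descents n \<alpha>) = k \<and>
     num_cycles n \<alpha> = k \<and> faces n \<alpha> + k + 2 * g = Suc n}"

lemma genus_class_permutes: "\<alpha> \<in> genus_class g n k \<Longrightarrow> \<alpha> permutes {1..n}"
  by (simp add: genus_class_def)

lemma finite_genus_class [simp]: "finite (genus_class g n k)"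
  by (rule finite_subset[OF _ finite_permutations[of "{1..n}"]]) (auto simp: genus_class_def)

lemma finite_stat_sets [simp]:
  "finite (descents n \<alpha>)" "finite (fixed_points n \<alpha>)" "finite (successions n \<alpha>)" "finite (chords n \<alpha>)"
  by (auto simp: descents_def fixed_points_def successions_def chords_def)

lemma inj_on_skip [simp]: "inj_on (skip i) A"
  by (simp add: inj_on_def)

text \<open>The equation \<open>faces n \<alpha> + k + 2 * g = Suc n\<close> keeps its
  \<open>g\<close> because both sides grow equally: here by the new part, for a succession by the
  new face, and for a chord by one part and one face against two points.\<close>

lemma insert_fixed_genus_class:
  assumes "\<alpha> permutes {1..n}" "1 \<le> i" "i \<le> Suc n"
  shows "insert_fixed i \<alpha> \<in> genus_class g (Suc n) (Suc k) \<longleftrightarrow> \<alpha> \<in> genus_class g n k"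
proof -
  have "card (insert i (skip i ` descents n \<alpha>)) = Suc (card (descents n \<alpha>))"
    by (subst card_insert_disjoint) (auto simp: card_image)
  then show ?thesis
    using assms insert_fixed_permutes[OF assms]
    by (auto simp: genus_class_def num_cycles_insert_fixed[OF assms]
        faces_insert_fixed[OF assms] descents_insert_fixed[OF assms])
qed

lemma insert_succ_genus_class:
  assumes "\<alpha> permutes {1..n}" "1 \<le> i" "i \<le> n"
  shows "insert_succ i \<alpha> \<in> genus_class g (Suc n) k \<longleftrightarrow> \<alpha> \<in> genus_class g n k"
  using assms insert_succ_permutes[OF assms]
  by (auto simp: genus_class_def num_cycles_insert_succ[OF assms] card_image
      faces_insert_succ[OF assms] descents_insert_succ[OF assms])

lemma insert_chord_genus_class:
  assumes "\<alpha> permutes {1..n}" "1 \<le> b" "b \<le> a" "a \<le> n" "\<alpha> a = b"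
  shows "insert_chord b (Suc (Suc a)) \<alpha> \<in> genus_class g (Suc (Suc n)) (Suc k) \<longleftrightarrow>
    \<alpha> \<in> genus_class g n k"
proof -
  have "card (insert (Suc (Suc a)) (embed b a ` descents n \<alpha>)) = Suc (card (descents n \<alpha>))"
    using assms
    by (subst card_insert_disjoint) (auto simp: card_image inj_on_subset[OF inj_embed])
  then show ?thesis
    using assms(1) insert_chord_permutes[OF assms]
    by (auto simp: genus_class_def num_cycles_insert_chord[OF assms]
        faces_insert_chord[OF assms] descents_insert_chord[OF assms])
qed

text \<open>The same partition arises by insertion once for each of its fixed points; remembering
  the inserted point makes insertion reversible.\<close>

lemma insert_fixed_bij:
  "bij_betw (\<lambda>(\<alpha>, i). (insert_fixed i \<alpha>, i)) (genus_class g n k \<times> {1..Suc n})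
     (SIGMA \<alpha>:genus_class g (Suc n) (Suc k). fixed_points (Suc n) \<alpha>)"
proof (rule bij_betw_byWitness[where f' = "\<lambda>(\<alpha>, i). (delete_fixed i \<alpha>, i)"])
  show "(\<lambda>(\<alpha>, i). (insert_fixed i \<alpha>, i)) ` (genus_class g n k \<times> {1..Suc n}) \<subseteq>
     (SIGMA \<alpha>:genus_class g (Suc n) (Suc k). fixed_points (Suc n) \<alpha>)"
    by (auto simp: insert_fixed_genus_class genus_class_permutes fixed_points_def simp del: One_nat_def)
  show "(\<lambda>(\<alpha>, i). (delete_fixed i \<alpha>, i)) `
     (SIGMA \<alpha>:genus_class g (Suc n) (Suc k). fixed_points (Suc n) \<alpha>) \<subseteq> genus_class g n k \<times> {1..Suc n}"
  proof safe
    fix \<alpha> i assume \<alpha>: "\<alpha> \<in> genus_class g (Suc n) (Suc k)" and "i \<in> fixed_points (Suc n) \<alpha>"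
    then have i: "\<alpha> i = i" "1 \<le> i" "i \<le> Suc n" by (auto simp: fixed_points_def)
    have p: "\<alpha> permutes {1..Suc n}" using \<alpha> by (rule genus_class_permutes)
    show "delete_fixed i \<alpha> \<in> genus_class g n k"
      using insert_fixed_genus_class[OF delete_fixed_permutes[OF p i] i(2,3)]
        insert_fixed_delete_fixed[OF permutes_inj[OF p] i(1)] \<alpha> by metis
    show "i \<in> {1..Suc n}" using i by simp
  qed
qed (auto simp: fixed_points_def intro: insert_fixed_delete_fixed dest: genus_class_permutes permutes_inj)

lemma insert_succ_bij:
  "bij_betw (\<lambda>(\<alpha>, i). (insert_succ i \<alpha>, i)) (genus_class g n k \<times> {1..n})
     (SIGMA \<alpha>:genus_class g (Suc n) k. successions (Suc n) \<alpha>)"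
proof (rule bij_betw_byWitness[where f' = "\<lambda>(\<alpha>, i). (delete_fixed i (transpose i (Suc i) \<circ> \<alpha>), i)"])
  have inv: "insert_succ i (delete_fixed i (transpose i (Suc i) \<circ> \<alpha>)) = \<alpha> \<and>
      delete_fixed i (transpose i (Suc i) \<circ> \<alpha>) permutes {1..n} \<and> 1 \<le> i \<and> i \<le> n"
    if \<alpha>: "\<alpha> \<in> genus_class g (Suc n) k" and si: "i \<in> successions (Suc n) \<alpha>" for \<alpha> i
  proof -
    have p: "\<alpha> permutes {1..Suc n}" using \<alpha> by (rule genus_class_permutes)
    have s: "\<alpha> i = Suc i" "i \<in> {1..Suc n}" using si by (auto simp: successions_def)
    \<comment> \<open>The last point \<open>n + 1\<close> is no succession, as its image would leave
      the interval. Hence only \<open>n\<close> positions are available.\<close>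
    then have "Suc i \<in> {1..Suc n}" using permutes_in_image[OF p, of i] by simp
    then have i: "1 \<le> i" "i \<le> Suc n" "i \<le> n" using s by auto
    have p': "transpose i (Suc i) \<circ> \<alpha> permutes {1..Suc n}"
      using i by (intro permutes_compose[OF p] permutes_swap_id) auto
    have fx: "(transpose i (Suc i) \<circ> \<alpha>) i = i" using s by simp
    have "insert_succ i (delete_fixed i (transpose i (Suc i) \<circ> \<alpha>)) = \<alpha>"
      unfolding insert_succ_def insert_fixed_delete_fixed[OF permutes_inj[OF p'] fx]
      by (simp add: fun_eq_iff)
    then show ?thesis
      using delete_fixed_permutes[OF p' fx i(1,2)] i by blast
  qed
  show "(\<lambda>(\<alpha>, i). (insert_succ i \<alpha>, i)) ` (genus_class g n k \<times> {1..n}) \<subseteq>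
     (SIGMA \<alpha>:genus_class g (Suc n) k. successions (Suc n) \<alpha>)"
    by (auto simp: insert_succ_genus_class genus_class_permutes successions_def simp del: One_nat_def)
  show "(\<lambda>(\<alpha>, i). (delete_fixed i (transpose i (Suc i) \<circ> \<alpha>), i)) `
     (SIGMA \<alpha>:genus_class g (Suc n) k. successions (Suc n) \<alpha>) \<subseteq> genus_class g n k \<times> {1..n}"
  proof (clarify, goal_cases)
    case (1 _ _ \<alpha> i)
    define \<alpha>' where "\<alpha>' = delete_fixed i (transpose i (Suc i) \<circ> \<alpha>)"
    from inv[OF 1] have a: "\<alpha>' permutes {1..n}" "1 \<le> i" "i \<le> n" and b: "insert_succ i \<alpha>' = \<alpha>"
      by (auto simp: \<alpha>'_def)
    from insert_succ_genus_class[OF a, of g k] 1(1) b a show ?case by (simp add: \<alpha>'_def)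
  qed
  show "\<forall>x\<in>genus_class g n k \<times> {1..n}. (case case x of (\<alpha>, i) \<Rightarrow> (insert_succ i \<alpha>, i) of
      (\<alpha>, i) \<Rightarrow> (delete_fixed i (transpose i (Suc i) \<circ> \<alpha>), i)) = x"
    by (auto simp: insert_succ_def simp flip: comp_assoc)
  show "\<forall>x\<in>SIGMA \<alpha>:genus_class g (Suc n) k. successions (Suc n) \<alpha>.
      (case case x of (\<alpha>, i) \<Rightarrow> (delete_fixed i (transpose i (Suc i) \<circ> \<alpha>), i) of
      (\<alpha>, i) \<Rightarrow> (insert_succ i \<alpha>, i)) = x"
    using inv by auto
qed

text \<open>The number of partitions in the class with \<open>m\<close> fixed points and
  \<open>l\<close> successions marked.\<close>

definition weight :: "nat \<Rightarrow> nat \<Rightarrow> nat \<Rightarrow> nat \<Rightarrow> nat \<Rightarrow> nat" where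
  "weight g m l n k = (\<Sum>\<alpha>\<in>genus_class g n k.
     (card (fixed_points n \<alpha>) choose m) * (card (successions n \<alpha>) choose l))"

text \<open>Both sides count partitions with \<open>m + 1\<close> marked fixed points, one of them
  distinguished, which is deleted. The recursion is run at \<open>l = 0\<close>, i.e. fixed points
  are inserted before all successions, because inserting a fixed point can destroy a
  succession.\<close>

lemma weight_Suc_fixed:
  "Suc m * weight g (Suc m) 0 (Suc n) (Suc k) = Suc n * weight g m 0 n k"
proof -
  have "Suc m * weight g (Suc m) 0 (Suc n) (Suc k) =
      (\<Sum>\<alpha>\<in>genus_class g (Suc n) (Suc k). \<Sum>i\<in>fixed_points (Suc n) \<alpha>.
        (card (fixed_points (Suc n) \<alpha>) - 1 choose m))"
    unfolding weight_def sum_distrib_left by (intro sum.cong refl) (simp add: binomial_absorption del: mult_Suc)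
  also have "\<dots> = (\<Sum>(\<alpha>, i)\<in>(SIGMA \<alpha>:genus_class g (Suc n) (Suc k). fixed_points (Suc n) \<alpha>).
        (card (fixed_points (Suc n) \<alpha>) - 1 choose m))"
    by (subst sum.Sigma) auto
  also have "\<dots> = (\<Sum>(\<alpha>, i)\<in>genus_class g n k \<times> {1..Suc n}.
        (card (fixed_points (Suc n) (insert_fixed i \<alpha>)) - 1 choose m))"
    by (subst sum.reindex_bij_betw[OF insert_fixed_bij, symmetric]) (simp add: case_prod_unfold)
  also have "\<dots> = (\<Sum>(\<alpha>, i)\<in>genus_class g n k \<times> {1..Suc n}. (card (fixed_points n \<alpha>) choose m))"
  proof (intro sum.cong refl, clarify)
    fix \<alpha> i assume "i \<in> {1..Suc n}"
    then have "card (fixed_points (Suc n) (insert_fixed i \<alpha>)) = Suc (card (fixed_points n \<alpha>))"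
      by (simp add: fixed_points_insert_fixed del: card_insert_if)
        (subst card_insert_disjoint, auto simp: card_image)
    then show "(card (fixed_points (Suc n) (insert_fixed i \<alpha>)) - 1 choose m) =
        (card (fixed_points n \<alpha>) choose m)" by simp
  qed
  also have "\<dots> = Suc n * weight g m 0 n k"
    by (subst sum.cartesian_product[symmetric]) (simp add: weight_def sum_distrib_left)
  finally show ?thesis .
qed

text \<open>The new point may go before any old point except the \<open>m\<close> marked fixed
  points, which it would destroy. Summed over all positions, the choices of \<open>m\<close>
  surviving fixed points therefore number \<open>n - m\<close> times the choices of \<open>m\<close>
  fixed points.\<close>

lemma weight_Suc_succ:
  "Suc l * weight g m (Suc l) (Suc n) k = (n - m) * weight g m l n k"
proof -
  let ?J = "\<lambda>n \<alpha>. card (fixed_points n \<alpha>)" and ?L = "\<lambda>n \<alpha>. card (successions n \<alpha>)"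
  have "Suc l * weight g m (Suc l) (Suc n) k =
      (\<Sum>\<alpha>\<in>genus_class g (Suc n) k. \<Sum>i\<in>successions (Suc n) \<alpha>.
        (?J (Suc n) \<alpha> choose m) * (?L (Suc n) \<alpha> - 1 choose l))"
    unfolding weight_def sum_distrib_left
    by (intro sum.cong refl) (simp add: binomial_absorption mult.left_commute[of "Suc l"] del: mult_Suc)
  also have "\<dots> = (\<Sum>(\<alpha>, i)\<in>(SIGMA \<alpha>:genus_class g (Suc n) k. successions (Suc n) \<alpha>).
        (?J (Suc n) \<alpha> choose m) * (?L (Suc n) \<alpha> - 1 choose l))"
    by (subst sum.Sigma) auto
  also have "\<dots> = (\<Sum>(\<alpha>, i)\<in>genus_class g n k \<times> {1..n}.
        (?J (Suc n) (insert_succ i \<alpha>) choose m) * (?L (Suc n) (insert_succ i \<alpha>) - 1 choose l))"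
    by (subst sum.reindex_bij_betw[OF insert_succ_bij, symmetric]) (simp add: case_prod_unfold)
  also have "\<dots> = (\<Sum>\<alpha>\<in>genus_class g n k. \<Sum>i\<in>{1..n}.
        (card (fixed_points n \<alpha> - {i}) choose m) * (?L n \<alpha> choose l))"
  proof (subst sum.cartesian_product[symmetric], intro sum.cong refl)
    fix \<alpha> i assume "\<alpha> \<in> genus_class g n k" "i \<in> {1..n}"
    then have a: "\<alpha> permutes {1..n}" "1 \<le> i" "i \<le> n"
      by (auto simp: genus_class_permutes simp del: One_nat_def)
    have "?L (Suc n) (insert_succ i \<alpha>) = Suc (?L n \<alpha>)"
      unfolding successions_insert_succ[OF a]
      by (subst card_insert_disjoint) (auto simp: card_image)
    then show "(?J (Suc n) (insert_succ i \<alpha>) choose m) * (?L (Suc n) (insert_succ i \<alpha>) - 1 choose l) =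
        (card (fixed_points n \<alpha> - {i}) choose m) * (?L n \<alpha> choose l)"
      unfolding fixed_points_insert_succ[OF a] by (simp add: card_image)
  qed
  also have "\<dots> = (\<Sum>\<alpha>\<in>genus_class g n k. (n - m) * ((?J n \<alpha> choose m) * (?L n \<alpha> choose l)))"
  proof (intro sum.cong refl)
    fix \<alpha>
    have sub: "fixed_points n \<alpha> \<subseteq> {1..n}" by (auto simp: fixed_points_def)
    define j where "j = ?J n \<alpha>"
    have j: "j \<le> n" unfolding j_def using card_mono[OF _ sub] by simp
    have "(\<Sum>i\<in>{1..n}. (card (fixed_points n \<alpha> - {i}) choose m)) =
        (\<Sum>i\<in>{1..n} - fixed_points n \<alpha>. (card (fixed_points n \<alpha> - {i}) choose m)) +
        (\<Sum>i\<in>fixed_points n \<alpha>. (card (fixed_points n \<alpha> - {i}) choose m))"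
      by (rule sum.subset_diff[OF sub]) simp
    also have "\<dots> = (n - j) * (j choose m) + j * (j - 1 choose m)"
    proof -
      have "card ({1..n} - fixed_points n \<alpha>) = n - j"
        using card_Diff_subset[OF _ sub] by (simp add: j_def)
      then show ?thesis by (simp add: j_def card_Diff_singleton)
    qed
    also have "j * (j - 1 choose m) = (j - m) * (j choose m)"
      using binomial_absorb_comp[of j m] by simp
    also have "(n - j) * (j choose m) + (j - m) * (j choose m) = (n - m) * (j choose m)"
      using j by (cases "m \<le> j") (auto simp flip: add_mult_distrib)
    finally show "(\<Sum>i\<in>{1..n}. (card (fixed_points n \<alpha> - {i}) choose m) * (?L n \<alpha> choose l)) =
        (n - m) * ((?J n \<alpha> choose m) * (?L n \<alpha> choose l))"
      by (simp add: j_def flip: sum_distrib_right)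
  qed
  finally show ?thesis by (simp add: weight_def sum_distrib_left)
qed

lemma card_stats_le:
  assumes "\<alpha> \<in> genus_class g n k"
  shows "card (fixed_points n \<alpha>) + card (successions n \<alpha>) \<le> n" "card (fixed_points n \<alpha>) \<le> k"
proof -
  have "card (fixed_points n \<alpha> \<union> successions n \<alpha>) \<le> card {1..n}"
    by (rule card_mono) (auto simp: fixed_points_def successions_def)
  moreover have "fixed_points n \<alpha> \<inter> successions n \<alpha> = {}"
    by (auto simp: fixed_points_def successions_def)
  ultimately show "card (fixed_points n \<alpha>) + card (successions n \<alpha>) \<le> n"
    by (simp add: card_Un_disjoint)
  have "card (fixed_points n \<alpha>) \<le> card (descents n \<alpha>)"
    by (rule card_mono) (auto simp: fixed_points_def descents_def)
  then show "card (fixed_points n \<alpha>) \<le> k" using assms by (simp add: genus_class_def)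
qed

lemma weight_eq_0:
  assumes "n < m + l \<or> k < m"
  shows "weight g m l n k = 0"
  unfolding weight_def
proof (rule sum.neutral, rule ballI)
  fix \<alpha> assume "\<alpha> \<in> genus_class g n k"
  from card_stats_le[OF this] assms
  show "(card (fixed_points n \<alpha>) choose m) * (card (successions n \<alpha>) choose l) = 0"
    by auto
qed

lemma weight_fixed_eq:
  "weight g m 0 (N + m) (K + m) = ((N + m) choose m) * card (genus_class g N K)"
proof (induction m)
  case 0
  show ?case by (simp add: weight_def)
next
  case (Suc m)
  have "Suc m * weight g (Suc m) 0 (N + Suc m) (K + Suc m) =
      Suc (N + m) * weight g m 0 (N + m) (K + m)"
    using weight_Suc_fixed[of m g "N + m" "K + m"] by simp
  also have "\<dots> = (Suc (N + m) * ((N + m) choose m)) * card (genus_class g N K)"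
    by (simp only: Suc mult.assoc)
  also have "Suc (N + m) * ((N + m) choose m) = Suc m * (Suc (N + m) choose Suc m)"
    by (rule Suc_times_binomial[symmetric])
  finally show ?case by (simp del: mult_Suc binomial_Suc_Suc add: mult.assoc)
qed

text \<open>\<open>N\<close> and \<open>K\<close> are the size and number of parts left when all
  marked points are deleted. With size \<open>N + m + l\<close>, the factor \<open>n - m\<close> of
  the recursion is \<open>N + l\<close>, independent of \<open>m\<close>, which makes the solution a
  product.\<close>

lemma weight_eq:
  "weight g m l (N + m + l) (K + m) =
     ((N + m) choose m) * ((N + l - 1) choose l) * card (genus_class g N K)"
proof (induction l)
  case 0
  show ?case by (simp add: weight_fixed_eq)
next
  case (Suc l)
  have "Suc l * weight g m (Suc l) (N + m + Suc l) (K + m) =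
      (N + l) * weight g m l (N + m + l) (K + m)"
    using weight_Suc_succ[of l g m "N + m + l" "K + m"] by (simp add: algebra_simps)
  also have "\<dots> = ((N + m) choose m) * ((N + l) * ((N + l - 1) choose l)) * card (genus_class g N K)"
    by (subst Suc) (simp only: ac_simps)
  also have "(N + l) * ((N + l - 1) choose l) = Suc l * ((N + l) choose Suc l)"
    by (rule binomial_absorption[symmetric])
  finally have "Suc l * weight g m (Suc l) (N + m + Suc l) (K + m) =
      Suc l * (((N + m) choose m) * ((N + l) choose Suc l) * card (genus_class g N K))"
    by (simp only: ac_simps)
  then show ?case by (simp del: mult_Suc)
qed

definition reduced_class :: "nat \<Rightarrow> nat \<Rightarrow> nat \<Rightarrow> (nat \<Rightarrow> nat) set" where
  "reduced_class g n k = {\<alpha> \<in> genus_class g n k. fixed_points n \<alpha> = {} \<and> successions n \<alpha> = {}}"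

lemma alternating_choose_sum:
  assumes "j \<le> n"
  shows "(\<Sum>i\<le>n. (-1) ^ i * of_nat (j choose i)) = (if j = 0 then 1 else 0 :: real)"
proof -
  have "(\<Sum>i\<le>n. (-1) ^ i * of_nat (j choose i)) = (\<Sum>i\<le>j. (-1) ^ i * of_nat (j choose i) :: real)"
    using assms by (intro sum.mono_neutral_right) auto
  then show ?thesis using choose_alternating_sum[of j, where 'a = real] by auto
qed

text \<open>Inclusion-exclusion, carried out for each permutation separately: the alternating sum of
  a row of binomial coefficients vanishes unless the row is the one for 0.\<close>

lemma card_reduced_class:
  "real (card (reduced_class g n k)) =
     (\<Sum>m\<le>n. \<Sum>l\<le>n. (-1) ^ (m + l) * real (weight g m l n k))"
proof -
  let ?J = "\<lambda>\<alpha>. card (fixed_points n \<alpha>)" and ?L = "\<lambda>\<alpha>. card (successions n \<alpha>)"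
  have "(\<Sum>m\<le>n. \<Sum>l\<le>n. (-1) ^ (m + l) * real (weight g m l n k)) =
      (\<Sum>m\<le>n. \<Sum>l\<le>n. \<Sum>\<alpha>\<in>genus_class g n k.
        ((-1) ^ m * real (?J \<alpha> choose m)) * ((-1) ^ l * real (?L \<alpha> choose l)))"
    by (simp add: weight_def sum_distrib_left power_add ac_simps)
  also have "\<dots> = (\<Sum>\<alpha>\<in>genus_class g n k. \<Sum>m\<le>n. \<Sum>l\<le>n.
        ((-1) ^ m * real (?J \<alpha> choose m)) * ((-1) ^ l * real (?L \<alpha> choose l)))"
    by (subst sum.swap[where B = "genus_class g n k"], subst sum.swap[where B = "genus_class g n k"]) simp
  also have "\<dots> = (\<Sum>\<alpha>\<in>genus_class g n k. (\<Sum>m\<le>n. (-1) ^ m * real (?J \<alpha> choose m)) *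
        (\<Sum>l\<le>n. (-1) ^ l * real (?L \<alpha> choose l)))"
    by (simp only: sum_product)
  also have "\<dots> = (\<Sum>\<alpha>\<in>genus_class g n k. if \<alpha> \<in> reduced_class g n k then 1 else 0)"
  proof (intro sum.cong refl)
    fix \<alpha> assume \<alpha>: "\<alpha> \<in> genus_class g n k"
    from card_stats_le(1)[OF this] have "?J \<alpha> \<le> n" "?L \<alpha> \<le> n" by auto
    then show "(\<Sum>m\<le>n. (-1) ^ m * real (?J \<alpha> choose m)) * (\<Sum>l\<le>n. (-1) ^ l * real (?L \<alpha> choose l)) =
        (if \<alpha> \<in> reduced_class g n k then 1 else 0)"
      using \<alpha> by (simp add: alternating_choose_sum reduced_class_def)
  qed
  also have "\<dots> = real (card (reduced_class g n k))"
  proof -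
    have "{x \<in> genus_class g n k. x \<in> reduced_class g n k} = reduced_class g n k"
      by (auto simp: reduced_class_def)
    then show ?thesis by (simp flip: sum.inter_filter)
  qed
  finally show ?thesis by simp
qed

section \<open>Partitions with a given number of chords\<close>

definition chord_class :: "nat \<Rightarrow> nat \<Rightarrow> nat \<Rightarrow> nat \<Rightarrow> (nat \<Rightarrow> nat) set" where
  "chord_class g c n k = {\<alpha> \<in> reduced_class g n k. card (chords n \<alpha>) = c}"

lemma insert_chord_chord_class:
  assumes "\<alpha> permutes {1..n}" "1 \<le> b" "b \<le> a" "a \<le> n" "\<alpha> a = b"
  shows "insert_chord b (Suc (Suc a)) \<alpha> \<in> chord_class g (Suc c) (Suc (Suc n)) (Suc k) \<longleftrightarrow>
    \<alpha> \<in> chord_class g c n k"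
proof -
  have "card (insert b (embed b a ` chords n \<alpha>)) = Suc (card (chords n \<alpha>))"
    using assms
    by (subst card_insert_disjoint) (auto simp: card_image inj_on_subset[OF inj_embed])
  then show ?thesis
    by (simp add: chord_class_def reduced_class_def insert_chord_genus_class[OF assms]
        fixed_points_insert_chord[OF assms] successions_insert_chord[OF assms] chords_insert_chord[OF assms])
qed

text \<open>A chord is determined by the weak descent that it encloses, so inserted chords
  correspond to weak descents. The inverse first multiplies by the transposition to make both
  endpoints fixed and then deletes them.\<close>

lemma insert_chord_bij:
  "bij_betw (\<lambda>(\<alpha>, a). (insert_chord (\<alpha> a) (Suc (Suc a)) \<alpha>, \<alpha> a))
     (SIGMA \<alpha>:chord_class g c n k. descents n \<alpha>)
     (SIGMA \<alpha>:chord_class g (Suc c) (Suc (Suc n)) (Suc k). chords (Suc (Suc n)) \<alpha>)"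
proof (rule bij_betw_byWitness[where f' = "\<lambda>(\<alpha>, i).
    (delete_fixed i (delete_fixed (\<alpha> i) (transpose i (\<alpha> i) \<circ> \<alpha>)), \<alpha> i - 2)"])
  have base: "\<alpha> permutes {1..n} \<and> 1 \<le> \<alpha> a \<and> \<alpha> a \<le> a \<and> a \<le> n"
    if "\<alpha> \<in> chord_class g c n k" "a \<in> descents n \<alpha>" for \<alpha> a
  proof -
    have p: "\<alpha> permutes {1..n}"
      using that by (auto simp: chord_class_def reduced_class_def genus_class_permutes simp del: One_nat_def)
    then show ?thesis using that(2) permutes_in_image[OF p, of a] by (auto simp: descents_def)
  qed
  have 2: "\<alpha>' permutes {1..n} \<and> 1 \<le> i \<and> i \<le> j - 2 \<and> j - 2 \<le> n \<and> \<alpha>' (j - 2) = i \<and>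
      Suc (Suc (j - 2)) = j \<and> insert_chord i j \<alpha>' = \<alpha>"
    if \<alpha>: "\<alpha> \<in> chord_class g (Suc c) (Suc (Suc n)) (Suc k)" and i: "i \<in> chords (Suc (Suc n)) \<alpha>"
      and j: "j = \<alpha> i" and \<alpha>': "\<alpha>' = delete_fixed i (delete_fixed j (transpose i j \<circ> \<alpha>))" for \<alpha> i j \<alpha>'
  proof -
    have p: "\<alpha> permutes {1..Suc (Suc n)}"
      using \<alpha> by (auto simp: chord_class_def reduced_class_def genus_class_permutes simp del: One_nat_def)
    have i': "1 \<le> i" "i \<le> Suc (Suc n)" "i < j" "\<alpha> j = i" "\<alpha> (j - 1) = Suc i"
      using i by (auto simp: chords_def j)
    then have jn: "j \<le> Suc (Suc n)" using permutes_in_image[OF p, of i] j by simp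
    have "fixed_points (Suc (Suc n)) \<alpha> = {}" "successions (Suc (Suc n)) \<alpha> = {}"
      using \<alpha> by (auto simp: chord_class_def reduced_class_def)
    then have "j \<noteq> Suc i" "\<alpha> (Suc i) \<noteq> Suc i"
      using i' jn j by (auto simp: fixed_points_def successions_def)
    \<comment> \<open>If \<open>j\<close> were \<open>i + 2\<close>, then
      \<open>\<alpha> (j - 1) = i + 1\<close> would make \<open>i + 1\<close> a fixed point. So a
      descent is really enclosed.\<close>
    then have j3: "j \<ge> Suc (Suc (Suc i))"
      using i' by (cases "j = Suc (Suc i)") auto
    define \<beta> where "\<beta> = transpose i j \<circ> \<alpha>"
    have p\<beta>: "\<beta> permutes {1..Suc (Suc n)}"
      unfolding \<beta>_def using i' jn by (intro permutes_compose[OF p] permutes_swap_id) auto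
    have fj: "\<beta> j = j" and fi: "\<beta> i = i" using i' j by (auto simp: \<beta>_def)
    have p1: "delete_fixed j \<beta> permutes {1..Suc n}"
      using i' jn by (intro delete_fixed_permutes p\<beta> fj) auto
    have f1: "delete_fixed j \<beta> i = i"
      using i' fi by (simp add: delete_fixed_def skip_def unskip_def)
    have p2: "\<alpha>' permutes {1..n}"
      unfolding \<alpha>' \<beta>_def[symmetric] using i' jn by (intro delete_fixed_permutes p1 f1) auto
    have eq: "insert_chord i j \<alpha>' = \<alpha>"
      unfolding insert_chord_def \<alpha>' \<beta>_def[symmetric]
        insert_fixed_delete_fixed[OF permutes_inj[OF p1] f1]
        insert_fixed_delete_fixed[OF permutes_inj[OF p\<beta>] fj]
      by (simp add: \<beta>_def fun_eq_iff)
    obtain a where a: "j = Suc (Suc a)" using that[of "j - 2"] j3 by simp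
    have ia: "i \<le> a" "a \<noteq> i" using j3 a by auto
    have "embed i a (\<alpha>' a) = \<alpha> (embed i a a)"
      using insert_chord_simps(3)[OF ia(1), of \<alpha>' a] eq a by simp
    also have "\<dots> = embed i a i" using i' ia a by (simp add: embed_def)
    finally have "\<alpha>' a = i" using ia by simp
    then show ?thesis using p2 i' ia jn a eq by simp
  qed
  show "\<forall>x\<in>SIGMA \<alpha>:chord_class g c n k. descents n \<alpha>.
      (case case x of (\<alpha>, a) \<Rightarrow> (insert_chord (\<alpha> a) (Suc (Suc a)) \<alpha>, \<alpha> a) of
       (\<alpha>, i) \<Rightarrow> (delete_fixed i (delete_fixed (\<alpha> i) (transpose i (\<alpha> i) \<circ> \<alpha>)), \<alpha> i - 2)) = x"
  proof (clarify, goal_cases)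
    case (1 \<alpha> a)
    then have "\<alpha> a \<le> a" by (auto simp: descents_def)
    have *: "transpose i j \<circ> insert_chord i j \<alpha> = insert_fixed j (insert_fixed i \<alpha>)" for i j
      by (simp add: insert_chord_def fun_eq_iff)
    show ?case by (simp add: insert_chord_simps(1)[OF \<open>\<alpha> a \<le> a\<close>] *)
  qed
  show "\<forall>x\<in>SIGMA \<alpha>:chord_class g (Suc c) (Suc (Suc n)) (Suc k). chords (Suc (Suc n)) \<alpha>.
      (case case x of (\<alpha>, i) \<Rightarrow>
        (delete_fixed i (delete_fixed (\<alpha> i) (transpose i (\<alpha> i) \<circ> \<alpha>)), \<alpha> i - 2) of
       (\<alpha>, a) \<Rightarrow> (insert_chord (\<alpha> a) (Suc (Suc a)) \<alpha>, \<alpha> a)) = x"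
  proof (clarify, goal_cases)
    case (1 \<alpha> i)
    from 2[OF this refl refl] show ?case by simp
  qed
  show "(\<lambda>(\<alpha>, a). (insert_chord (\<alpha> a) (Suc (Suc a)) \<alpha>, \<alpha> a)) `
      (SIGMA \<alpha>:chord_class g c n k. descents n \<alpha>) \<subseteq>
      (SIGMA \<alpha>:chord_class g (Suc c) (Suc (Suc n)) (Suc k). chords (Suc (Suc n)) \<alpha>)"
  proof (clarify, goal_cases)
    case (1 _ _ \<alpha> a)
    then have a: "\<alpha> permutes {1..n}" "1 \<le> \<alpha> a" "\<alpha> a \<le> a" "a \<le> n" using base[OF 1] by auto
    show ?case
      using insert_chord_chord_class[OF a refl] chords_insert_chord[OF a refl] 1 by simp
  qed
  show "(\<lambda>(\<alpha>, i). (delete_fixed i (delete_fixed (\<alpha> i) (transpose i (\<alpha> i) \<circ> \<alpha>)), \<alpha> i - 2)) `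
      (SIGMA \<alpha>:chord_class g (Suc c) (Suc (Suc n)) (Suc k). chords (Suc (Suc n)) \<alpha>) \<subseteq>
      (SIGMA \<alpha>:chord_class g c n k. descents n \<alpha>)"
  proof (clarify, goal_cases)
    case (1 _ _ \<alpha> i)
    define j where "j = \<alpha> i"
    define \<alpha>' where "\<alpha>' = delete_fixed i (delete_fixed j (transpose i j \<circ> \<alpha>))"
    from 2[OF 1 j_def \<alpha>'_def]
    have a: "\<alpha>' permutes {1..n}" "1 \<le> i" "i \<le> j - 2" "j - 2 \<le> n" "\<alpha>' (j - 2) = i"
      and b: "insert_chord i (Suc (Suc (j - 2))) \<alpha>' = \<alpha>" by auto
    have "\<alpha>' \<in> chord_class g c n k"
      using insert_chord_chord_class[OF a] 1 b by simp
    moreover have "j - 2 \<in> descents n \<alpha>'" using a by (auto simp: descents_def)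
    ultimately show ?case by (simp add: \<alpha>'_def j_def)
  qed
qed

lemma chord_class_subset: "chord_class g c n k \<subseteq> genus_class g n k"
  by (auto simp: chord_class_def reduced_class_def)

lemma finite_chord_class [simp]: "finite (chord_class g c n k)"
  using chord_class_subset finite_genus_class by (rule finite_subset)

text \<open>Pairs in the bijection are counted on both sides. Here the partition property enters:
  there are exactly \<open>k\<close> weak descents, hence \<open>k\<close> places for a new
  chord.\<close>

lemma card_chord_class_Suc:
  "Suc c * card (chord_class g (Suc c) (Suc (Suc n)) (Suc k)) = k * card (chord_class g c n k)"
proof -
  have "Suc c * card (chord_class g (Suc c) (Suc (Suc n)) (Suc k)) =
      card (SIGMA \<alpha>:chord_class g (Suc c) (Suc (Suc n)) (Suc k). chords (Suc (Suc n)) \<alpha>)"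
    by (subst card_SigmaI, simp, simp) (simp add: chord_class_def)
  also have "\<dots> = card (SIGMA \<alpha>:chord_class g c n k. descents n \<alpha>)"
    by (rule bij_betw_same_card[OF insert_chord_bij, symmetric])
  also have "\<dots> = (\<Sum>\<alpha>\<in>chord_class g c n k. k)"
    by (subst card_SigmaI, simp, simp)
      (auto intro!: sum.cong simp: chord_class_def reduced_class_def genus_class_def)
  finally show ?thesis by simp
qed

text \<open>The binomial coefficient is the number of ways to distribute \<open>c\<close> chords
  over \<open>K\<close> stacks, one around the weak descent of each part.\<close>

lemma card_chord_class:
  "card (chord_class g c (N + 2 * c) (K + c)) = ((K + c - 1) choose c) * card (chord_class g 0 N K)"
proof (induction c)
  case (Suc c)
  have "Suc c * card (chord_class g (Suc c) (N + 2 * Suc c) (K + Suc c)) =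
      (K + c) * card (chord_class g c (N + 2 * c) (K + c))"
    using card_chord_class_Suc[of c g "N + 2 * c" "K + c"] by simp
  also have "\<dots> = ((K + c) * ((K + c - 1) choose c)) * card (chord_class g 0 N K)"
    by (subst Suc) (simp only: ac_simps)
  also have "(K + c) * ((K + c - 1) choose c) = Suc c * ((K + c) choose Suc c)"
    by (rule binomial_absorption[symmetric])
  finally show ?case by (simp del: mult_Suc add: mult.assoc)
qed simp

text \<open>Each chord uses two points and a part of its own. The induction reads this off from the
  recursion, whose right-hand side vanishes.\<close>

lemma chord_class_empty:
  assumes "n < 2 * c \<or> k < c"
  shows "chord_class g c n k = {}"
  using assms
proof (induction c arbitrary: n k)
  case (Suc c)
  show ?case
  proof (cases "n < 2 \<or> k = 0")
    case True
    have "chords n \<alpha> = {}" if "\<alpha> \<in> genus_class g n k" for \<alpha>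
    proof (rule ccontr)
      assume "chords n \<alpha> \<noteq> {}"
      then obtain i where i: "i \<in> {1..n}" "i < \<alpha> i" "\<alpha> (\<alpha> i) = i" by (auto simp: chords_def)
      then have "\<alpha> i \<in> {1..n}"
        using permutes_in_image[OF genus_class_permutes[OF that]] by blast
      then have "\<alpha> i \<in> descents n \<alpha>" "n \<ge> 2" using i by (auto simp: descents_def)
      moreover from this have "k > 0"
        using that card_gt_0_iff[of "descents n \<alpha>"] by (auto simp: genus_class_def)
      ultimately show False using True by auto
    qed
    then show ?thesis by (auto simp: chord_class_def reduced_class_def)
  next
    case False
    then obtain n' k' where nk: "n = Suc (Suc n')" "k = Suc k'"
      using that[of "n - 2" "k - 1"] by auto
    with Suc have "chord_class g c n' k' = {}" by auto
    with card_chord_class_Suc[of c g n' k'] show ?thesis unfolding nk by simp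
  qed
qed auto

lemma card_reduced_class_chords:
  "card (reduced_class g n k) = (\<Sum>c\<le>n. card (chord_class g c n k))"
proof -
  have "card (chords n \<alpha>) \<le> n" for \<alpha>
  proof -
    have "chords n \<alpha> \<subseteq> {1..n}" by (auto simp: chords_def)
    from card_mono[OF _ this] show ?thesis by simp
  qed
  then have "reduced_class g n k = (\<Union>c\<le>n. chord_class g c n k)"
    by (auto simp: chord_class_def)
  moreover have "chord_class g c n k \<inter> chord_class g d n k = {}" if "c \<noteq> d" for c d
    using that by (auto simp: chord_class_def)
  ultimately show ?thesis by (simp add: card_UN_disjoint)
qed

section \<open>Finiteness of the set of irreducible partitions\<close>

lemma orbits_partition:
  assumes "f permutes A" "finite A"
  shows "\<Union>(orbit f ` A) = A" "\<And>X. X \<in> orbit f ` A \<Longrightarrow> finite X"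
    "\<And>X Y. X \<in> orbit f ` A \<Longrightarrow> Y \<in> orbit f ` A \<Longrightarrow> X \<noteq> Y \<Longrightarrow> X \<inter> Y = {}"
proof -
  have p: "permutation f" using assms permutation_permutes by blast
  show "\<Union>(orbit f ` A) = A"
    using permutation_self_in_orbit[OF p] permutes_orbit_subset[OF assms(1)] by blast
  show "finite X" if "X \<in> orbit f ` A" for X
    using that permutes_orbit_subset[OF assms(1)] assms(2) finite_subset by blast
  show "X \<inter> Y = {}" if "X \<in> orbit f ` A" "Y \<in> orbit f ` A" "X \<noteq> Y" for X Y
    using that orbit_eq_of_mem[OF p] by (metis disjoint_iff imageE)
qed

lemma card_eq_sum_orbits:
  assumes "f permutes A" "finite A" "E \<subseteq> A"
  shows "card E = (\<Sum>X\<in>orbit f ` A. card (X \<inter> E))"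
proof -
  have "E = (\<Union>X\<in>orbit f ` A. X \<inter> E)"
    using orbits_partition(1)[OF assms(1,2)] assms(3) by blast
  then have "card E = card (\<Union>X\<in>orbit f ` A. X \<inter> E)" by simp
  also have "\<dots> = (\<Sum>X\<in>orbit f ` A. card (X \<inter> E))"
    using orbits_partition[OF assms(1,2)] assms(2) by (intro card_UN_disjoint) blast+
  finally show ?thesis .
qed

text \<open>An orbit of at least three points contributes at least 6 to the first summand alone; one
  of two points contributes 4 there and 2 to the second.\<close>

lemma card_orbits_fixfree_le:
  assumes f: "f permutes A" "finite A" and nofix: "\<And>t. t \<in> A \<Longrightarrow> f t \<noteq> t"
  shows "6 * card (orbit f ` A) \<le> 2 * card A + card {t \<in> A. f (f t) = t}"
proof -
  define E where "E = {t \<in> A. f (f t) = t}"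
  have "6 \<le> 2 * card X + card (X \<inter> E)" if X: "X \<in> orbit f ` A" for X
  proof -
    obtain x where x: "x \<in> A" "X = orbit f x" using X by auto
    have fin: "finite X" and sub: "X \<subseteq> A"
      using orbits_partition(1,2)[OF f] X by blast+
    have in_X: "x \<in> X" "f x \<in> X" "f (f x) \<in> X"
      using permutation_self_in_orbit[of f x] f permutation_permutes x by (auto intro: orbit.intros)
    have "{x, f x} \<subseteq> X" using in_X by simp
    then have "card {x, f x} \<le> card X" using fin by (rule card_mono[rotated])
    then have two: "2 \<le> card X" using nofix[OF x(1)] by auto
    show ?thesis
    proof (cases "card X = 2")
      case True
      have "{x, f x} = X"
        using nofix[OF x(1)] True \<open>{x, f x} \<subseteq> X\<close> fin by (intro card_subset_eq) auto
      moreover have "f (f x) \<noteq> f x" using nofix in_X sub by blast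
      ultimately have "f (f x) = x" using in_X by blast
      then have "X \<subseteq> E" using \<open>{x, f x} = X\<close> sub by (auto simp: E_def)
      then show ?thesis using True by (simp add: Int_absorb2)
    qed (use two in linarith)
  qed
  then have "(\<Sum>X\<in>orbit f ` A. 6) \<le> (\<Sum>X\<in>orbit f ` A. 2 * card X + card (X \<inter> E))"
    by (rule sum_mono)
  also have "\<dots> = 2 * (\<Sum>X\<in>orbit f ` A. card (X \<inter> A)) + card E"
  proof -
    have "X \<inter> A = X" if "X \<in> orbit f ` A" for X
      using that orbits_partition(1)[OF f] by blast
    then show ?thesis
      using card_eq_sum_orbits[OF f, of E] by (simp add: sum.distrib sum_distrib_left E_def)
  qed
  also have "\<dots> = 2 * card A + card E" using card_eq_sum_orbits[OF f, of A] by simp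
  finally show ?thesis by (simp add: E_def)
qed

text \<open>Euler's formula forces almost all cycles of a chord-free reduced \<open>\<alpha>\<close> and of its face
  permutation to be 2-cycles. A point \<open>i\<close> on a 2-cycle of both sits on a chord
  \<open>{\<alpha> i, i}\<close> with \<open>\<alpha> i < i\<close> parallel to the step from \<open>\<alpha> i - 1\<close> to \<open>i + 1\<close>, and
  \<open>\<alpha> i - 1\<close> is not on a 2-cycle of \<open>\<alpha>\<close>, so there are few such points as well.\<close>
lemma chord_free_bound:
  assumes \<alpha>: "\<alpha> \<in> chord_class g 0 n k"
  shows "n \<le> 24 * g"
proof (cases "n = 0")
  case False
  have mem: "\<alpha> \<in> genus_class g n k" and fp: "fixed_points n \<alpha> = {}"
    and su: "successions n \<alpha> = {}" and ch: "chords n \<alpha> = {}"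
    using \<alpha> by (auto simp: chord_class_def reduced_class_def)
  have p: "\<alpha> permutes {1..n}" using mem by (rule genus_class_permutes)
  have genus: "num_cycles n \<alpha> = k" "faces n \<alpha> + k + 2 * g = Suc n"
    using mem by (auto simp: genus_class_def)
  have inj: "\<alpha> x = \<alpha> y \<longleftrightarrow> x = y" for x y using permutes_inj[OF p] by (simp add: inj_eq)
  have \<alpha>0: "\<alpha> 0 = 0" using permutes_not_in[OF p] by simp
  have \<alpha>in: "1 \<le> \<alpha> t" "\<alpha> t \<le> n" if "1 \<le> t" "t \<le> n" for t
    using permutes_in_image[OF p, of t] that by auto
  have ne: "\<alpha> t \<noteq> t" "\<alpha> t \<noteq> Suc t" if "1 \<le> t" "t \<le> n" for t
    using fp su that by (auto simp: fixed_points_def successions_def)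
  define \<sigma> where "\<sigma> = inv \<alpha> \<circ> rot n"
  have \<alpha>\<sigma>: "\<alpha> (\<sigma> t) = rot n t" for t by (simp add: \<sigma>_def permutes_inverses[OF p])
  have p\<sigma>: "\<sigma> permutes {0..n}" unfolding \<sigma>_def by (rule face_perm[OF p])
  define E1 where "E1 = {t \<in> {1..n}. \<alpha> (\<alpha> t) = t}"
  define E2 where "E2 = {t \<in> {0..n}. \<sigma> (\<sigma> t) = t}"
  have "6 * card (orbit \<alpha> ` {1..n}) \<le> 2 * card {1..n} + card E1"
    unfolding E1_def using ne by (intro card_orbits_fixfree_le p) auto
  then have b1: "6 * k \<le> 2 * n + card E1" using genus by (simp add: num_cycles_def)
  \<comment> \<open>A fixed point of the face permutation would be a succession. At the ends 0 and
    \<open>n\<close> it is excluded because \<open>\<alpha>\<close> fixes 0 and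
    \<open>n \<noteq> 0\<close>.\<close>
  have "\<sigma> t \<noteq> t" if "t \<in> {0..n}" for t
  proof
    assume "\<sigma> t = t"
    then have "\<alpha> t = rot n t" using \<alpha>\<sigma>[of t] by simp
    then show False using that \<alpha>0 False ne[of t] \<alpha>in[of t] by (cases "t = 0") (auto simp: rot_def split: if_splits)
  qed
  then have "6 * card (orbit \<sigma> ` {0..n}) \<le> 2 * card {0..n} + card E2"
    unfolding E2_def by (intro card_orbits_fixfree_le p\<sigma>) auto
  then have b2: "6 * faces n \<alpha> \<le> 2 * n + 2 + card E2" by (simp add: faces_def \<sigma>_def)
  have fin: "finite E1" "finite E2" and sub: "E1 \<subseteq> {1..n}" "E2 \<subseteq> {0..n}"
    by (auto simp: E1_def E2_def)
  have "card (E1 \<union> E2) \<le> card {0..n}" by (rule card_mono) (auto simp: E1_def E2_def)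
  then have b3: "card E1 + card E2 \<le> Suc n + card (E1 \<inter> E2)"
    using card_Un_Int[OF fin] by simp
  have b4: "card E2 \<le> Suc n" using card_mono[OF _ sub(2)] by simp
  have b5: "card E1 \<le> n" using card_mono[OF _ sub(1)] by simp
  \<comment> \<open>The point \<open>n\<close> is left out because \<open>rot n\<close> wraps there;
    it costs 1 in the estimate of \<open>E1 \<inter> E2\<close> below.\<close>
  have key: "2 \<le> \<alpha> i \<and> \<alpha> i \<le> n \<and> \<alpha> i - 1 \<notin> E1" if i: "i \<in> E1 \<inter> E2 - {n}" for i
  proof -
    define j where "j = \<alpha> i"
    have i': "1 \<le> i" "i < n" "\<alpha> j = i" using i by (auto simp: E1_def j_def)
    have j': "1 \<le> j" "j \<le> n" using \<alpha>in[of i] i' by (auto simp: j_def)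
    have "\<alpha> (\<sigma> i) = Suc i" using \<alpha>\<sigma>[of i] i' by (simp add: rot_def)
    moreover have "rot n (\<sigma> i) = j" using \<alpha>\<sigma>[of "\<sigma> i"] i by (simp add: E2_def j_def)
    moreover have "\<sigma> i \<noteq> 0" using \<open>\<alpha> (\<sigma> i) = Suc i\<close> \<alpha>0 by (metis nat.distinct(1))
    ultimately have \<sigma>: "\<sigma> i = j - 1" "2 \<le> j"
      using j' by (auto simp: rot_def split: if_splits)
    then have step: "\<alpha> (j - 1) = Suc i" using \<open>\<alpha> (\<sigma> i) = Suc i\<close> by simp
    have "\<not> i < j" using ch i' step by (auto simp: chords_def j_def)
    then have "j < i" using ne[of i] i' by (simp add: j_def)
    \<comment> \<open>Otherwise \<open>j - 1\<close> and \<open>i + 1\<close> would form a 2-cycle,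
      and since \<open>\<alpha> i = j\<close> this would be a chord around
      \<open>{j, i}\<close>.\<close>
    have "j - 1 \<notin> E1"
    proof
      assume "j - 1 \<in> E1"
      then have "j - 1 \<in> chords n \<alpha>"
        using step \<open>j < i\<close> i' j' \<sigma> by (auto simp: E1_def chords_def j_def)
      then show False using ch by simp
    qed
    then show ?thesis using \<sigma> j' by (simp add: j_def)
  qed
  have "card (E1 \<inter> E2 - {n}) \<le> card ({1..n} - E1)"
  proof (rule card_inj_on_le[where f = "\<lambda>i. \<alpha> i - 1"])
    show "inj_on (\<lambda>i. \<alpha> i - 1) (E1 \<inter> E2 - {n})"
    proof (rule inj_onI)
      fix x y assume xy: "x \<in> E1 \<inter> E2 - {n}" "y \<in> E1 \<inter> E2 - {n}" "\<alpha> x - 1 = \<alpha> y - 1"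
      from key[OF xy(1)] key[OF xy(2)] xy(3) have "\<alpha> x = \<alpha> y" by linarith
      then show "x = y" by (simp add: inj)
    qed
    show "(\<lambda>i. \<alpha> i - 1) ` (E1 \<inter> E2 - {n}) \<subseteq> {1..n} - E1"
    proof (rule image_subsetI)
      fix i assume "i \<in> E1 \<inter> E2 - {n}"
      from key[OF this] show "\<alpha> i - 1 \<in> {1..n} - E1" by auto
    qed
  qed simp
  also have "card ({1..n} - E1) = n - card E1" using sub fin by (simp add: card_Diff_subset)
  finally have "card (E1 \<inter> E2 - {n}) \<le> n - card E1" .
  then have "card (E1 \<inter> E2) \<le> Suc (n - card E1)"
    by (cases "n \<in> E1 \<inter> E2") (simp_all add: card_Diff_singleton)
  \<comment> \<open>Write \<open>e1\<close>, \<open>e2\<close> for the sizes of \<open>E1\<close>,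
    \<open>E2\<close>. By \<open>b1\<close>, \<open>b2\<close> and Euler's formula,
    \<open>e1 + e2 \<ge> 2 * n + 4 - 12 * g\<close>; by \<open>b3\<close> and the injection,
    \<open>2 * e1 + e2 \<le> 2 * n + 2\<close>. Hence \<open>e1 \<le> 12 * g - 2\<close>, and
    \<open>b4\<close> gives \<open>n \<le> 24 * g - 5\<close>.\<close>
  then show ?thesis using b1 b2 b3 b4 b5 genus(2) by linarith
qed simp

section \<open>Partitions and weak descents\<close>

lemma cycle_of_list_upt:
  assumes "a \<le> b"
  shows "cycle_of_list [a..<Suc b] t = (if a \<le> t \<and> t < b then Suc t else if t = b then a else t)"
  using assms
proof (induction a rule: inc_induct)
  case (step a)
  then have "[a..<Suc b] = a # Suc a # [Suc (Suc a)..<Suc b]"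
    by (simp add: upt_conv_Cons)
  moreover have "[Suc a..<Suc b] = Suc a # [Suc (Suc a)..<Suc b]"
    using step by (simp add: upt_conv_Cons)
  ultimately have "cycle_of_list [a..<Suc b] t = transpose a (Suc a) (cycle_of_list [Suc a..<Suc b] t)"
    by simp
  then show ?case
    unfolding step.IH using step.hyps by (auto simp: transpose_def)
qed simp

text \<open>Since \<open>inv \<alpha>\<close> fixes 0, the cycle of the face permutation passes from
  \<open>n\<close> through 0 to the image of 1 under \<open>inv \<alpha>\<close>. Skipping 0 yields
  the permutation with \<open>zeta n\<close>.\<close>

lemma faces_eq_num_cycles:
  assumes p: "\<alpha> permutes {1..n}" and n: "n \<ge> 1"
  shows "num_cycles n (inv \<alpha> \<circ> zeta n) = faces n \<alpha>"
proof -
  let ?f = "inv \<alpha> \<circ> rot n"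
  have pf: "permutation ?f" using face_perm[OF p] by (rule permutes_permutation)
  have zeta: "zeta n t = (if t < n then Suc t else 1)" if "t \<in> {1..n}" for t
    using n that unfolding zeta_def by (subst cycle_of_list_upt) auto
  have inv_in: "inv \<alpha> t \<in> {1..n} \<longleftrightarrow> t \<in> {1..n}" for t
    using permutes_in_image[OF permutes_inv[OF p]] .
  have inv0: "inv \<alpha> 0 = 0" using permutes_not_in[OF permutes_inv[OF p], of 0] by simp
  have "card (orbit (inv \<alpha> \<circ> zeta n) ` {1..n}) = card (orbit ?f ` id ` {1..n})"
  proof (rule card_orbits_pullback[OF pf inj_on_id])
    fix t assume t: "t \<in> {1..n}"
    show "(inv \<alpha> \<circ> zeta n) t \<in> {1..n}" using inv_in t n by (auto simp: zeta)
    show "id ((inv \<alpha> \<circ> zeta n) t) = ?f (id t) \<or>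
        ?f (id t) \<notin> id ` {1..n} \<and> id ((inv \<alpha> \<circ> zeta n) t) = ?f (?f (id t))"
      using t n by (cases "t < n") (auto simp: zeta rot_def inv0)
  qed
  also have "\<dots> = card (orbit ?f ` insert 0 {1..n})"
  proof (simp only: image_id id_apply, rule card_orbits_insert_old[OF pf, symmetric])
    show "?f 0 \<in> orbit ?f 0" by (rule orbit.base)
    show "?f 0 \<in> {1..n}" using inv_in n by (simp add: rot_def)
  qed
  also have "insert 0 {1..n} = {0..n}" by auto
  finally show ?thesis unfolding num_cycles_def faces_def .
qed

text \<open>The last entry of the list maps back to the minimum \<open>m\<close> and is always a
  weak descent. Any further one is a place where the list fails to increase.\<close>

lemma sorted_support_iff:
  assumes p: "permutation \<alpha>" and m: "m = Min (orbit \<alpha> m)"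
  shows "sorted_wrt (<) (support \<alpha> m) \<longleftrightarrow> card {t \<in> orbit \<alpha> m. \<alpha> t \<le> (t::nat)} = 1"
proof -
  define l where "l = support \<alpha> m"
  define r where "r = least_power \<alpha> m"
  have r: "(\<alpha> ^^ r) m = m" "r > 0"
    unfolding r_def by (rule least_power_of_permutation[OF p])+
  have len: "length l = r" and nth: "\<And>i. i < r \<Longrightarrow> l ! i = (\<alpha> ^^ i) m"
    by (auto simp: l_def r_def)
  have set_l: "set l = orbit \<alpha> m"
    unfolding l_def support_set[OF p] orbit_altdef_permutation[OF p] by auto
  have dist: "distinct l" unfolding l_def by (rule cycle_of_permutation[OF p])
  have step: "\<alpha> (l ! i) = l ! Suc i" if "Suc i < r" for i
    using that by (simp add: nth)
  define z where "z = l ! (r - 1)"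
  have \<alpha>z: "\<alpha> z = m"
    using r by (cases r) (simp_all add: z_def nth)
  have z_in: "z \<in> orbit \<alpha> m" using r len set_l by (metis diff_less less_one nth_mem z_def)
  have fin: "finite (orbit \<alpha> m)" using set_l by (metis List.finite_set)
  have "m \<le> z" using Min_le[OF fin z_in] by (simp flip: m)
  then have z_desc: "z \<in> {t \<in> orbit \<alpha> m. \<alpha> t \<le> t}" using z_in \<alpha>z by simp
  have "sorted_wrt (<) l \<longleftrightarrow> (\<forall>i. Suc i < r \<longrightarrow> l ! i < l ! Suc i)"
    by (simp add: sorted_wrt_iff_nth_Suc_transp len)
  also have "\<dots> \<longleftrightarrow> {t \<in> orbit \<alpha> m. \<alpha> t \<le> t} = {z}"
  proof
    assume *: "\<forall>i. Suc i < r \<longrightarrow> l ! i < l ! Suc i"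
    have "t = z" if "t \<in> orbit \<alpha> m" "\<alpha> t \<le> t" for t
    proof -
      have "t \<in> set l" using that(1) set_l by simp
      then obtain i where i: "i < r" "t = l ! i" using len by (auto simp: in_set_conv_nth)
      have "\<not> Suc i < r" using * step[of i] that(2) unfolding i(2) by (metis not_le)
      then have "i = r - 1" using i by simp
      then show ?thesis using i by (simp add: z_def)
    qed
    then show "{t \<in> orbit \<alpha> m. \<alpha> t \<le> t} = {z}" using z_desc by blast
  next
    assume *: "{t \<in> orbit \<alpha> m. \<alpha> t \<le> t} = {z}"
    show "\<forall>i. Suc i < r \<longrightarrow> l ! i < l ! Suc i"
    proof (intro allI impI)
      fix i assume i: "Suc i < r"
      have "l ! i \<noteq> z" unfolding z_def using i dist len by (simp add: nth_eq_iff_index_eq)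
      moreover have "l ! i \<in> orbit \<alpha> m" using i len set_l by (metis Suc_lessD nth_mem)
      ultimately have "\<not> \<alpha> (l ! i) \<le> l ! i" using * by blast
      then show "l ! i < l ! Suc i" using step[OF i] by simp
    qed
  qed
  also have "\<dots> \<longleftrightarrow> card {t \<in> orbit \<alpha> m. \<alpha> t \<le> t} = 1"
  proof
    assume "card {t \<in> orbit \<alpha> m. \<alpha> t \<le> t} = 1"
    then obtain x where x: "{t \<in> orbit \<alpha> m. \<alpha> t \<le> t} = {x}" by (rule card_1_singletonE)
    with z_desc have "z \<in> {x}" by (simp only:)
    with x show "{t \<in> orbit \<alpha> m. \<alpha> t \<le> t} = {z}" by (simp only: singleton_iff)
  qed simp
  finally show ?thesis by (simp add: l_def)
qed

lemma is_partition_iff: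
  "is_partition n \<alpha> \<longleftrightarrow> \<alpha> permutes {1..n} \<and> card (descents n \<alpha>) = num_cycles n \<alpha>"
proof (cases "\<alpha> permutes {1..n}")
  case p: True
  have perm: "permutation \<alpha>" using p by (rule permutes_permutation)
  note part = orbits_partition[OF p finite_atLeastAtMost]
  have sub: "orbit \<alpha> m \<subseteq> {1..n}" if "m \<in> {1..n}" for m
    using permutes_orbit_subset[OF p that] .
  define D where "D X = X \<inter> descents n \<alpha>" for X
  have D_orbit: "D (orbit \<alpha> m) = {t \<in> orbit \<alpha> m. \<alpha> t \<le> t}" if "m \<in> {1..n}" for m
    using sub[OF that] by (auto simp: D_def descents_def)
  \<comment> \<open>The greatest element of a cycle is a weak descent. So the surpluses
    \<open>card (D X) - 1\<close> below involve no truncation, and their sum vanishes only if each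
    of them does.\<close>
  have pos: "1 \<le> card (D X)" if X: "X \<in> orbit \<alpha> ` {1..n}" for X
  proof -
    obtain m where m: "m \<in> {1..n}" "X = orbit \<alpha> m" using X by auto
    have fin: "finite X" using part X by blast
    have "Max X \<in> X" using fin m orbit_nonempty[of \<alpha> m] by simp
    moreover from this have "\<alpha> (Max X) \<in> X" unfolding m by (rule orbit.step)
    then have "\<alpha> (Max X) \<le> Max X" by (rule Max_ge[OF fin])
    ultimately have "Max X \<in> D X" using D_orbit m by blast
    then show ?thesis using fin by (metis D_def One_nat_def Suc_leI card_gt_0_iff empty_iff finite_Int)
  qed
  have "card (descents n \<alpha>) = (\<Sum>X\<in>orbit \<alpha> ` {1..n}. card (D X))"
    unfolding D_def by (intro card_eq_sum_orbits[OF p]) (auto simp: descents_def)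
  also have "\<dots> = (\<Sum>X\<in>orbit \<alpha> ` {1..n}. 1 + (card (D X) - 1))"
    using pos by (intro sum.cong refl) (metis le_add_diff_inverse)
  also have "\<dots> = num_cycles n \<alpha> + (\<Sum>X\<in>orbit \<alpha> ` {1..n}. card (D X) - 1)"
    by (simp only: sum.distrib) (simp add: num_cycles_def)
  finally have "card (descents n \<alpha>) = num_cycles n \<alpha> \<longleftrightarrow>
      (\<forall>X\<in>orbit \<alpha> ` {1..n}. card (D X) - 1 = 0)" by simp
  also have "\<dots> \<longleftrightarrow> (\<forall>X\<in>orbit \<alpha> ` {1..n}. card (D X) = 1)"
    using pos by force
  also have "\<dots> \<longleftrightarrow> (\<forall>m\<in>{1..n}. m = Min (orbit \<alpha> m) \<longrightarrow> card (D (orbit \<alpha> m)) = 1)"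
  proof
    assume *: "\<forall>m\<in>{1..n}. m = Min (orbit \<alpha> m) \<longrightarrow> card (D (orbit \<alpha> m)) = 1"
    show "\<forall>X\<in>orbit \<alpha> ` {1..n}. card (D X) = 1"
    proof
      fix X assume X: "X \<in> orbit \<alpha> ` {1..n}"
      then obtain m where m: "m \<in> {1..n}" "X = orbit \<alpha> m" by auto
      have "Min X \<in> X" using part(2)[OF X] m orbit_nonempty[of \<alpha> m] by simp
      then have "orbit \<alpha> (Min X) = X" "Min X \<in> {1..n}"
        using m orbit_eq_of_mem[OF perm] sub by blast+
      then show "card (D X) = 1" using * by metis
    qed
  qed auto
  also have "\<dots> \<longleftrightarrow> (\<forall>m\<in>{1..n}. m = Min (orbit \<alpha> m) \<longrightarrow> sorted_wrt (<) (support \<alpha> m))"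
  proof (intro ball_cong refl imp_cong)
    fix m assume "m \<in> {1..n}" "m = Min (orbit \<alpha> m)"
    from D_orbit[OF this(1)] sorted_support_iff[OF perm this(2)]
    show "card (D (orbit \<alpha> m)) = 1 \<longleftrightarrow> sorted_wrt (<) (support \<alpha> m)"
      by (metis (no_types))
  qed
  finally show ?thesis using p by (auto simp: is_partition_def)
qed (simp add: is_partition_def)

lemma num_partitions_eq:
  assumes "n \<ge> 1"
  shows "num_partitions g n k = card (genus_class g n k)"
proof -
  have "{\<alpha>. is_partition n \<alpha> \<and> has_genus n \<alpha> g \<and> num_cycles n \<alpha> = k} = genus_class g n k"
    using assms by (auto simp: is_partition_iff genus_class_def has_genus_def faces_eq_num_cycles)
  then show ?thesis by (simp add: num_partitions_def)
qed

lemma genus_class_0: "card (genus_class g 0 k) = (if g = 0 \<and> k = 0 then 1 else 0)"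
proof -
  have f: "faces 0 id = 1" by (simp add: faces_def)
  have "genus_class g 0 k = (if g = 0 \<and> k = 0 then {id} else {})"
    using f by (auto simp: genus_class_def descents_def num_cycles_def)
  then show ?thesis by simp
qed

lemma genus_class_no_parts:
  assumes "n \<ge> 1"
  shows "genus_class g n 0 = {}"
  using assms by (auto simp: genus_class_def num_cycles_def)

section \<open>Generating functions\<close>

definition geo :: "'a :: comm_ring_1 \<Rightarrow> 'a fps" where
  "geo a = Abs_fps (\<lambda>n. a ^ n)"

lemma geo_mult: "geo a * (1 - fps_const a * fps_X) = 1"
proof (rule fps_ext)
  fix n
  show "(geo a * (1 - fps_const a * fps_X)) $ n = 1 $ n"
    by (cases n) (simp_all add: geo_def algebra_simps)
qed

text \<open>The negative binomial series; the induction step is the hockey-stick identity.\<close>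

lemma geo_power_Suc_nth:
  "(geo a ^ Suc N) $ m = of_nat ((N + m) choose m) * a ^ m"
proof (induction N arbitrary: m)
  case (Suc N)
  have "(geo a ^ Suc (Suc N)) $ m = (\<Sum>i=0..m. (geo a ^ Suc N) $ i * geo a $ (m - i))"
    by (subst power_Suc2) (rule fps_mult_nth)
  also have "\<dots> = (\<Sum>i\<le>m. of_nat ((N + i) choose i) * a ^ m)"
    unfolding atLeast0AtMost
  proof (intro sum.cong refl)
    fix i assume "i \<in> {..m}"
    then have "a ^ i * a ^ (m - i) = a ^ m" by (simp flip: power_add)
    then show "(geo a ^ Suc N) $ i * geo a $ (m - i) = of_nat ((N + i) choose i) * a ^ m"
      unfolding Suc.IH by (simp add: geo_def mult.assoc)
  qed
  also have "\<dots> = of_nat (\<Sum>i\<le>m. (N + i) choose i) * a ^ m"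
    by (simp add: sum_distrib_right)
  finally show ?case by (simp add: sum_choose_lower)
qed (simp add: geo_def)

text \<open>Truncated subtraction gives the right value at \<open>N = 0\<close> as well: the
  binomial coefficient is then 1 for \<open>m = 0\<close> and 0 otherwise.\<close>

lemma geo_power_nth:
  "(geo a ^ N) $ m = of_nat ((N + m - 1) choose m) * a ^ m"
proof (cases N)
  case 0
  then show ?thesis by (cases m) (auto simp: binomial_eq_0)
qed (simp add: geo_power_Suc_nth del: power_Suc)

lemma compose_X_squared_nth:
  fixes F :: "'a :: comm_ring_1 fps"
  shows "(F oo fps_X ^ 2) $ n = (if even n then F $ (n div 2) else 0)"
proof -
  have "(F oo fps_X ^ 2) $ n = (\<Sum>i=0..n. if n = 2 * i then F $ i else 0)"
    unfolding fps_compose_nth by (intro sum.cong refl) (simp flip: power_mult)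
  also have "\<dots> = (if even n then F $ (n div 2) else 0)"
  proof (cases "even n")
    case True
    then have "(\<Sum>i=0..n. if n = 2 * i then F $ i else 0) = (\<Sum>i=0..n. if i = n div 2 then F $ i else 0)"
      by (intro sum.cong refl if_cong) auto
    then show ?thesis using True by simp
  qed (auto intro!: sum.neutral)
  finally show ?thesis .
qed

lemma geo_eq_compose:
  fixes F :: "'a :: idom fps"
  assumes "F $ 0 = 0"
  shows "(geo a oo F) * (1 - fps_const a * F) = 1"
proof -
  have "(geo a * (1 - fps_const a * fps_X)) oo F = 1"
    by (simp only: geo_mult fps_compose_1)
  then show ?thesis
    using assms by (simp add: fps_compose_mult_distrib fps_compose_sub_distrib)
qed

definition two_var_gf :: "(nat \<Rightarrow> nat \<Rightarrow> nat) \<Rightarrow> real fps fps" where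
  "two_var_gf p = Abs_fps (\<lambda>n. Abs_fps (\<lambda>k. real (p n k)))"

text \<open>The series \<open>x / ((1 + x) * (1 + x * y))\<close>. The first \<open>fps_X\<close> is
  the outer variable \<open>x\<close>; the argument \<open>- fps_X\<close> of \<open>geo\<close> is
  a coefficient, so that \<open>fps_X\<close> is \<open>y\<close>.\<close>

definition leaf_subst :: "real fps fps" where
  "leaf_subst = fps_X * geo (- 1) * geo (- fps_X)"

text \<open>The product is \<open>x ^ N\<close> over
  \<open>(1 + x) ^ N * (1 + x * y) ^ (N + 1)\<close>. The additional factor accounts for the
  difference between the binomial coefficients for fixed points and for successions: there are
  \<open>N + 1\<close> gaps for the former.\<close>

lemma leaf_subst_power_nth:
  "(leaf_subst ^ N * geo (- fps_X)) $ n =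
     (if n < N then 0 else \<Sum>l\<le>n - N. of_nat ((N + l - 1) choose l) * (- 1) ^ l *
        (of_nat ((N + (n - N - l)) choose (n - N - l)) * (- fps_X) ^ (n - N - l)))"
proof -
  have "leaf_subst ^ N * geo (- fps_X) = fps_X ^ N * (geo (- 1) ^ N * geo (- fps_X) ^ Suc N)"
    by (simp add: leaf_subst_def power_mult_distrib algebra_simps)
  then show ?thesis
    by (simp only: fps_X_power_mult_nth fps_mult_nth[of "geo (- 1) ^ N"] geo_power_nth[of "- 1"]
        geo_power_Suc_nth atLeast0AtMost)
qed

lemma sum_triangle_swap:
  fixes f :: "nat \<Rightarrow> nat \<Rightarrow> 'a :: comm_monoid_add"
  assumes "\<And>m l. n < m + l \<Longrightarrow> f m l = 0"
  shows "(\<Sum>m\<le>n. \<Sum>l\<le>n. f m l) = (\<Sum>N\<le>n. \<Sum>l\<le>n - N. f (n - N - l) l)"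
proof -
  have "(\<Sum>m\<le>n. \<Sum>l\<le>n. f m l) = (\<Sum>m\<le>n. \<Sum>l\<le>n - m. f m l)"
    by (intro sum.cong[OF refl] sum.mono_neutral_right ballI assms) auto
  also have "\<dots> = (\<Sum>(m, l)\<in>(SIGMA m:{..n}. {..n - m}). f m l)"
    by (rule sum.Sigma) auto
  also have "\<dots> = (\<Sum>(N, l)\<in>(SIGMA N:{..n}. {..n - N}). f (n - N - l) l)"
    by (rule sum.reindex_bij_witness[of _ "\<lambda>(N, l). (n - N - l, l)" "\<lambda>(m, l). (n - m - l, l)"]) auto
  also have "\<dots> = (\<Sum>N\<le>n. \<Sum>l\<le>n - N. f (n - N - l) l)"
    by (rule sum.Sigma[symmetric]) auto
  finally show ?thesis .
qed

lemma compose_mult_nth: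
  fixes P V W :: "'a :: comm_ring_1 fps"
  assumes "V $ 0 = 0"
  shows "((P oo V) * W) $ n = (\<Sum>N\<le>n. P $ N * (V ^ N * W) $ n)"
proof -
  have "(P oo V) $ j = (\<Sum>N\<le>n. P $ N * (V ^ N) $ j)" if "j \<le> n" for j
    unfolding fps_compose_nth using that startsby_zero_power_prefix[OF assms]
    by (intro sum.mono_neutral_left) auto
  then have "((P oo V) * W) $ n = (\<Sum>j=0..n. (\<Sum>N\<le>n. P $ N * (V ^ N) $ j) * W $ (n - j))"
    unfolding fps_mult_nth by (intro sum.cong refl) auto
  also have "\<dots> = (\<Sum>N\<le>n. \<Sum>j=0..n. P $ N * ((V ^ N) $ j * W $ (n - j)))"
    by (simp add: sum_distrib_right mult.assoc) (rule sum.swap)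
  also have "\<dots> = (\<Sum>N\<le>n. P $ N * (V ^ N * W) $ n)"
    by (simp add: fps_mult_nth sum_distrib_left)
  finally show ?thesis .
qed

text \<open>With \<open>n = N + m + l\<close>, the exponent \<open>l\<close> comes from the powers
  of \<open>1 / (1 + x)\<close> and \<open>m\<close> from those of \<open>1 / (1 + x * y)\<close>;
  the signs of the two series are the signs of inclusion-exclusion.\<close>

lemma inclusion_exclusion_gf:
  fixes w :: "nat \<Rightarrow> nat \<Rightarrow> nat \<Rightarrow> nat \<Rightarrow> nat" and p r :: "nat \<Rightarrow> nat \<Rightarrow> nat"
  assumes r: "\<And>n k. real (r n k) = (\<Sum>m\<le>n. \<Sum>l\<le>n. (-1) ^ (m + l) * real (w m l n k))"
    and w0: "\<And>m l n k. n < m + l \<or> k < m \<Longrightarrow> w m l n k = 0"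
    and w: "\<And>m l N K. w m l (N + m + l) (K + m) = ((N + m) choose m) * ((N + l - 1) choose l) * p N K"
  shows "two_var_gf r = (two_var_gf p oo leaf_subst) * geo (- fps_X)"
proof (intro fps_ext)
  fix n k
  have V0: "leaf_subst $ 0 = 0" by (simp add: leaf_subst_def)
  have term_eq: "(two_var_gf p $ N * (of_nat ((N + l - 1) choose l) * (- 1) ^ l *
        (of_nat ((N + m) choose m) * (- fps_X) ^ m))) $ k =
      (-1) ^ (m + l) * real (w m l n k)"
    if "n = N + m + l" for N l m
  proof -
    define c where "c = (-1) ^ (m + l) * real ((N + m) choose m) * real ((N + l - 1) choose l)"
    have "two_var_gf p $ N * (of_nat ((N + l - 1) choose l) * (- 1) ^ l *
        (of_nat ((N + m) choose m) * (- fps_X) ^ m)) = fps_const c * (two_var_gf p $ N * fps_X ^ m)"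
      unfolding c_def power_minus[of fps_X m]
      by (simp add: power_add fps_of_nat flip: fps_const_mult fps_const_power fps_const_neg fps_const_1_eq_1)
    then have "(two_var_gf p $ N * (of_nat ((N + l - 1) choose l) * (- 1) ^ l *
        (of_nat ((N + m) choose m) * (- fps_X) ^ m))) $ k =
        c * (if k < m then 0 else real (p N (k - m)))"
      by (simp only:) (simp add: fps_X_power_mult_right_nth two_var_gf_def)
    also have "\<dots> = (-1) ^ (m + l) * real (w m l n k)"
      using w[of m l N "k - m"] w0[of n m l k] that by (auto simp: c_def)
    finally show ?thesis .
  qed
  have "((two_var_gf p oo leaf_subst) * geo (- fps_X)) $ n $ k =
      (\<Sum>N\<le>n. two_var_gf p $ N * (leaf_subst ^ N * geo (- fps_X)) $ n) $ k"
    by (simp only: compose_mult_nth[OF V0])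
  also have "\<dots> = (\<Sum>N\<le>n. \<Sum>l\<le>n - N. (two_var_gf p $ N * (of_nat ((N + l - 1) choose l) * (- 1) ^ l *
        (of_nat ((N + (n - N - l)) choose (n - N - l)) * (- fps_X) ^ (n - N - l)))) $ k)"
    unfolding fps_sum_nth leaf_subst_power_nth
    by (intro sum.cong refl) (simp add: sum_distrib_left fps_sum_nth)
  also have "\<dots> = (\<Sum>N\<le>n. \<Sum>l\<le>n - N. (-1) ^ (n - N - l + l) * real (w (n - N - l) l n k))"
    by (intro sum.cong refl term_eq) auto
  also have "\<dots> = (\<Sum>m\<le>n. \<Sum>l\<le>n. (-1) ^ (m + l) * real (w m l n k))"
    by (rule sum_triangle_swap[symmetric]) (simp add: w0)
  finally show "two_var_gf r $ n $ k = ((two_var_gf p oo leaf_subst) * geo (- fps_X)) $ n $ k"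
    by (simp add: two_var_gf_def r)
qed

text \<open>A chord adds two points and a part, i.e. a factor \<open>x\<^sup>2 * y\<close> in
  ordinary notation, and each of the \<open>K\<close> parts carries a stack of any height. This is
  the factor \<open>geo fps_X oo fps_X ^ 2\<close>, the series \<open>1 / (1 - y * x ^ 2)\<close>,
  to the power \<open>K\<close>.\<close>

lemma chord_gf:
  fixes c :: "nat \<Rightarrow> nat \<Rightarrow> nat \<Rightarrow> nat" and r :: "nat \<Rightarrow> nat \<Rightarrow> nat"
  assumes r: "\<And>n k. r n k = (\<Sum>j\<le>n. c j n k)"
    and c0: "\<And>j n k. n < 2 * j \<or> k < j \<Longrightarrow> c j n k = 0"
    and c: "\<And>j N K. c j (N + 2 * j) (K + j) = ((K + j - 1) choose j) * c 0 N K"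
    and bound: "\<And>N K. c 0 N K \<noteq> 0 \<Longrightarrow> N \<le> M \<and> K \<le> M"
  shows "two_var_gf r = (\<Sum>N\<le>M. \<Sum>K\<le>M. of_nat (c 0 N K) *
    (fps_X ^ N * vary ^ K * (geo fps_X oo fps_X ^ 2) ^ K))"
proof (intro fps_ext)
  fix n k
  have X2: "(fps_X ^ 2 :: real fps fps) $ 0 = 0" by simp
  have coeff_eq: "(fps_X ^ N * vary ^ K * (geo fps_X oo fps_X ^ 2) ^ K) $ n $ k =
      (if N \<le> n \<and> even (n - N) \<and> k = K + (n - N) div 2
       then real ((k - 1) choose ((n - N) div 2)) else 0)" for N K
  proof -
    have "(fps_X ^ N * vary ^ K * (geo fps_X oo fps_X ^ 2) ^ K :: real fps fps) =
        fps_X ^ N * (fps_const (fps_X ^ K) * (geo fps_X ^ K oo fps_X ^ 2))"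
      by (simp add: vary_def fps_compose_power[OF X2] fps_const_power mult.assoc)
    then have "(fps_X ^ N * vary ^ K * (geo fps_X oo fps_X ^ 2) ^ K :: real fps fps) $ n =
        (if N \<le> n \<and> even (n - N)
         then fps_X ^ K * (of_nat ((K + (n - N) div 2 - 1) choose ((n - N) div 2)) * fps_X ^ ((n - N) div 2))
         else 0)"
      by (simp only: fps_X_power_mult_nth fps_mult_left_const_nth compose_X_squared_nth geo_power_nth)
        auto
    also have "\<dots> = (if N \<le> n \<and> even (n - N)
         then fps_const (real ((K + (n - N) div 2 - 1) choose ((n - N) div 2))) * fps_X ^ (K + (n - N) div 2)
         else 0)"
      by (simp only: power_add fps_of_nat mult.left_commute)
    finally show ?thesis by (auto split: if_splits)
  qed
  let ?t = "\<lambda>N K. real (c 0 N K) * (if N \<le> n \<and> even (n - N) \<and> k = K + (n - N) div 2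
       then real ((k - 1) choose ((n - N) div 2)) else 0)"
  have "(\<Sum>N\<le>M. \<Sum>K\<le>M. of_nat (c 0 N K) *
      (fps_X ^ N * vary ^ K * (geo fps_X oo fps_X ^ 2) ^ K)) $ n $ k = (\<Sum>N\<le>M. \<Sum>K\<le>M. ?t N K)"
    by (simp add: fps_sum_nth fps_of_nat[symmetric] coeff_eq)
  also have "\<dots> = (\<Sum>(N, K)\<in>{..M} \<times> {..M}. ?t N K)"
    by (rule sum.cartesian_product)
  also have "\<dots> = (\<Sum>(N, K)\<in>{z \<in> {..M} \<times> {..M}. case z of (N, K) \<Rightarrow> ?t N K \<noteq> 0}. ?t N K)"
    by (rule sum.mono_neutral_right) (auto split: if_splits)
  also have "\<dots> = (\<Sum>j\<in>{j \<in> {..n}. c j n k \<noteq> 0}. real (c j n k))"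
  proof (rule sum.reindex_bij_witness[where
      i = "\<lambda>j. (n - 2 * j, k - j)" and j = "\<lambda>(N, K). (n - N) div 2"])
    have cj: "c j n k = ((k - 1) choose j) * c 0 (n - 2 * j) (k - j)" if "2 * j \<le> n" "j \<le> k" for j
      using c[of j "n - 2 * j" "k - j"] that by simp
    {
      fix z assume mem: "z \<in> {z \<in> {..M} \<times> {..M}. case z of (N, K) \<Rightarrow> ?t N K \<noteq> 0}"
      obtain N K where zNK: "z = (N, K)" by (cases z)
      with mem have z: "z = (N, K)" "?t N K \<noteq> 0" "N \<le> M" "K \<le> M"
        by (simp_all del: mult_eq_0_iff)
      then have NK: "N \<le> n" "even (n - N)" "k = K + (n - N) div 2" by (auto split: if_splits)
      define j where "j = (n - N) div 2"
      have n: "n = N + 2 * j" using NK by (simp add: j_def)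
      have k: "k = K + j" using NK by (simp add: j_def)
      show "(case case z of (N, K) \<Rightarrow> (n - N) div 2 of j \<Rightarrow> (n - 2 * j, k - j)) = z"
        using z n k by simp
      show "(case z of (N, K) \<Rightarrow> (n - N) div 2) \<in> {j \<in> {..n}. c j n k \<noteq> 0}"
        using z n k cj[of j] by (auto split: if_splits)
      show "real (c (case z of (N, K) \<Rightarrow> (n - N) div 2) n k) = (case z of (N, K) \<Rightarrow> ?t N K)"
        using z n k cj[of j] by auto
    }
    fix j assume "j \<in> {j \<in> {..n}. c j n k \<noteq> 0}"
    then have nz: "c j n k \<noteq> 0" by simp
    then have "\<not> (n < 2 * j \<or> k < j)" using c0[of n j k] by metis
    then have le: "2 * j \<le> n" "j \<le> k" by auto
    show "(case (n - 2 * j, k - j) of (N, K) \<Rightarrow> (n - N) div 2) = j" using le by simp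
    show "(n - 2 * j, k - j) \<in> {z \<in> {..M} \<times> {..M}. case z of (N, K) \<Rightarrow> ?t N K \<noteq> 0}"
    proof -
      have nz': "(k - 1) choose j \<noteq> 0" "c 0 (n - 2 * j) (k - j) \<noteq> 0"
        using nz cj[OF le] by (metis mult_is_0)+
      have "n - (n - 2 * j) = 2 * j" using le by simp
      then show ?thesis using nz' le bound[OF nz'(2)] by simp
    qed
  qed
  also have "\<dots> = (\<Sum>j\<le>n. real (c j n k))"
    by (rule sum.mono_neutral_left) auto
  finally show "two_var_gf r $ n $ k = (\<Sum>N\<le>M. \<Sum>K\<le>M. of_nat (c 0 N K) *
    (fps_X ^ N * vary ^ K * (geo fps_X oo fps_X ^ 2) ^ K)) $ n $ k"
    by (simp add: two_var_gf_def r)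
qed

section \<open>The quadratic extension of the rational functions\<close>

lemma poly_map_poly_add:
  assumes "h 0 = 0" "\<And>a b. h (a + b) = h a + h b"
  shows "poly (map_poly h (p + q)) x = poly (map_poly h p) x + poly (map_poly h q) x"
  by (induction p q rule: poly_induct2) (simp_all add: assms map_poly_pCons algebra_simps)

lemma poly_map_poly_smult:
  assumes "h 0 = 0" "\<And>a b. h (a * b) = h a * h b"
  shows "poly (map_poly h (smult c p)) x = h c * poly (map_poly h p) x"
  by (induction p) (simp_all add: assms map_poly_pCons algebra_simps)

lemma poly_map_poly_mult:
  assumes "h 0 = 0" "\<And>a b. h (a + b) = h a + h b" "\<And>a b. h (a * b) = h a * h b"
  shows "poly (map_poly h (p * q)) x = poly (map_poly h p) x * poly (map_poly h q) x"
proof (induction p)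
  case (pCons a p)
  have "poly (map_poly h (pCons a p * q)) x =
      h a * poly (map_poly h q) x + x * poly (map_poly h (p * q)) x"
    unfolding mult_pCons_left poly_map_poly_add[OF assms(1,2)] poly_map_poly_smult[OF assms(1,3)]
    by (simp add: map_poly_pCons assms)
  then show ?case using pCons.IH by (simp add: map_poly_pCons assms algebra_simps)
qed simp

lemma const2_simps:
  "const2 0 = 0" "const2 1 = 1" "const2 (a + b) = const2 a + const2 b" "const2 (a * b) = const2 a * const2 b"
  by (simp_all add: const2_def)

lemma eval1_simps:
  "eval1 0 u = 0" "eval1 (pCons c p) u = const2 c + u * eval1 p u"
  "eval1 (p + q) u = eval1 p u + eval1 q u" "eval1 (p * q) u = eval1 p u * eval1 q u"
  unfolding eval1_def
  by (simp_all add: const2_simps map_poly_pCons poly_map_poly_add poly_map_poly_mult)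

lemma eval2_simps:
  "eval2 0 u v = 0" "eval2 (pCons c p) u v = eval1 c u + v * eval2 p u v"
  "eval2 (p + q) u v = eval2 p u v + eval2 q u v" "eval2 (p * q) u v = eval2 p u v * eval2 q u v"
  unfolding eval2_def
  by (simp_all add: eval1_simps map_poly_pCons poly_map_poly_add poly_map_poly_mult)

lemma eval3_simps:
  "eval3 0 u v w = 0" "eval3 (pCons c p) u v w = eval2 c u v + w * eval3 p u v w"
  unfolding eval3_def by (simp_all add: eval2_simps map_poly_pCons)

abbreviation eval_xy :: "real poly poly \<Rightarrow> real fps fps fract" where
  "eval_xy A \<equiv> to_fract (eval2 A varx vary)"

text \<open>A denominator that is nonzero only as a polynomial would give the junk value 0,
  which is also a quotient with a denominator that does not vanish.\<close>
lemma ratfuns_xy_iff: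
  "z \<in> ratfuns_xy \<longleftrightarrow> (\<exists>A B. eval_xy B \<noteq> 0 \<and> z = eval_xy A / eval_xy B)"
proof
  assume "z \<in> ratfuns_xy"
  then obtain A B where z: "z = eval_xy A / eval_xy B" by (auto simp: ratfuns_xy_def)
  show "\<exists>A B. eval_xy B \<noteq> 0 \<and> z = eval_xy A / eval_xy B"
  proof (cases "eval_xy B = 0")
    case True
    have "eval_xy [:1:] = 1" by (simp add: eval2_simps eval1_simps const2_simps one_pCons)
    then show ?thesis using z True by (intro exI[of _ 0] exI[of _ "[:1:]"]) (simp add: eval2_simps)
  qed (use z in blast)
next
  assume "\<exists>A B. eval_xy B \<noteq> 0 \<and> z = eval_xy A / eval_xy B"
  then obtain A B where z: "eval_xy B \<noteq> 0" "z = eval_xy A / eval_xy B" by blast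
  then have "B \<noteq> 0" by (auto simp: eval2_simps)
  with z show "z \<in> ratfuns_xy" by (auto simp: ratfuns_xy_def)
qed

lemma ratfuns_xy_eval: "eval_xy A \<in> ratfuns_xy"
  unfolding ratfuns_xy_iff
  by (intro exI[of _ A] exI[of _ "[:1:]"]) (simp add: eval2_simps eval1_simps const2_simps one_pCons)

lemma ratfuns_xy_add:
  assumes "y \<in> ratfuns_xy" "z \<in> ratfuns_xy"
  shows "y + z \<in> ratfuns_xy"
proof -
  obtain A B where y: "eval_xy B \<noteq> 0" "y = eval_xy A / eval_xy B"
    using assms(1) by (auto simp: ratfuns_xy_iff simp del: to_fract_eq_0_iff)
  obtain C D where z: "eval_xy D \<noteq> 0" "z = eval_xy C / eval_xy D"
    using assms(2) by (auto simp: ratfuns_xy_iff simp del: to_fract_eq_0_iff)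
  show ?thesis
    unfolding ratfuns_xy_iff using y z
    by (intro exI[of _ "A * D + C * B"] exI[of _ "B * D"])
      (simp add: eval2_simps add_frac_eq del: to_fract_eq_0_iff)
qed

lemma ratfuns_xy_mult:
  assumes "y \<in> ratfuns_xy" "z \<in> ratfuns_xy"
  shows "y * z \<in> ratfuns_xy"
proof -
  obtain A B where y: "eval_xy B \<noteq> 0" "y = eval_xy A / eval_xy B"
    using assms(1) by (auto simp: ratfuns_xy_iff simp del: to_fract_eq_0_iff)
  obtain C D where z: "eval_xy D \<noteq> 0" "z = eval_xy C / eval_xy D"
    using assms(2) by (auto simp: ratfuns_xy_iff simp del: to_fract_eq_0_iff)
  show ?thesis
    unfolding ratfuns_xy_iff using y z
    by (intro exI[of _ "A * C"] exI[of _ "B * D"]) (simp add: eval2_simps del: to_fract_eq_0_iff)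
qed

lemma ratfuns_xy_const: "to_fract (const2 c) \<in> ratfuns_xy"
  using ratfuns_xy_eval[of "[:[:c:]:]"] by (simp add: eval2_simps eval1_simps)

lemma ratfuns_xy_simple:
  "0 \<in> ratfuns_xy" "1 \<in> ratfuns_xy" "to_fract varx \<in> ratfuns_xy" "to_fract vary \<in> ratfuns_xy"
  using ratfuns_xy_const[of 0] ratfuns_xy_const[of 1] ratfuns_xy_eval[of "[:[:0, 1:]:]"]
    ratfuns_xy_eval[of "[:0, [:1:]:]"]
  by (simp_all add: eval2_simps eval1_simps const2_simps)

lemma ratfuns_xy_uminus: "z \<in> ratfuns_xy \<Longrightarrow> - z \<in> ratfuns_xy"
  using ratfuns_xy_mult[OF ratfuns_xy_const[of "- 1"], of z] by (simp add: const2_def flip: fps_const_neg)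

lemma ratfuns_xy_diff: "y \<in> ratfuns_xy \<Longrightarrow> z \<in> ratfuns_xy \<Longrightarrow> y - z \<in> ratfuns_xy"
  using ratfuns_xy_add[of y "- z"] ratfuns_xy_uminus by simp

lemma ratfuns_xy_inverse:
  assumes "z \<in> ratfuns_xy"
  shows "inverse z \<in> ratfuns_xy"
proof (cases "z = 0")
  case False
  obtain A B where z: "eval_xy B \<noteq> 0" "z = eval_xy A / eval_xy B"
    using assms by (auto simp: ratfuns_xy_iff simp del: to_fract_eq_0_iff)
  with False have "eval_xy A \<noteq> 0" by auto
  then show ?thesis unfolding ratfuns_xy_iff using z
    by (intro exI[of _ B] exI[of _ A]) simp
qed (simp add: ratfuns_xy_simple)

lemmas ratfuns_xy_closed = ratfuns_xy_simple ratfuns_xy_const ratfuns_xy_add ratfuns_xy_mult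
  ratfuns_xy_uminus ratfuns_xy_diff ratfuns_xy_inverse

section \<open>Adjoining a square root of a rational function\<close>

definition quadratic_ext :: "real fps fps fract \<Rightarrow> real fps fps fract set" where
  "quadratic_ext s = {a + b * s | a b. a \<in> ratfuns_xy \<and> b \<in> ratfuns_xy}"

context
  fixes s :: "real fps fps fract"
  assumes sq: "s ^ 2 \<in> ratfuns_xy"
begin

lemma quadratic_extI: "a \<in> ratfuns_xy \<Longrightarrow> b \<in> ratfuns_xy \<Longrightarrow> z = a + b * s \<Longrightarrow> z \<in> quadratic_ext s"
  by (auto simp: quadratic_ext_def)

lemma quadratic_ext_base: "a \<in> ratfuns_xy \<Longrightarrow> a \<in> quadratic_ext s"
  by (rule quadratic_extI[of a 0]) (auto simp: ratfuns_xy_closed)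

lemma quadratic_ext_gen: "s \<in> quadratic_ext s"
  by (rule quadratic_extI[of 0 1]) (auto simp: ratfuns_xy_closed)

lemma quadratic_ext_add:
  assumes "y \<in> quadratic_ext s" "z \<in> quadratic_ext s"
  shows "y + z \<in> quadratic_ext s"
proof -
  from assms obtain a b c d where
    "{a, b, c, d} \<subseteq> ratfuns_xy" "y = a + b * s" "z = c + d * s" by (auto simp: quadratic_ext_def)
  then show ?thesis
    by (intro quadratic_extI[of "a + c" "b + d"]) (auto simp: ratfuns_xy_closed algebra_simps)
qed

lemma quadratic_ext_mult:
  assumes "y \<in> quadratic_ext s" "z \<in> quadratic_ext s"
  shows "y * z \<in> quadratic_ext s"
proof -
  from assms obtain a b c d where
    "{a, b, c, d} \<subseteq> ratfuns_xy" "y = a + b * s" "z = c + d * s" by (auto simp: quadratic_ext_def)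
  then show ?thesis using sq
    by (intro quadratic_extI[of "a * c + b * d * s ^ 2" "a * d + b * c"])
      (auto simp: ratfuns_xy_closed algebra_simps power2_eq_square)
qed

lemma quadratic_ext_inverse:
  assumes "z \<in> quadratic_ext s"
  shows "inverse z \<in> quadratic_ext s"
proof -
  from assms obtain a b where ab: "a \<in> ratfuns_xy" "b \<in> ratfuns_xy" "z = a + b * s"
    by (auto simp: quadratic_ext_def)
  define N where "N = a ^ 2 - b ^ 2 * s ^ 2"
  have N: "N = z * (a - b * s)" by (simp add: N_def ab(3) algebra_simps power2_eq_square)
  have N_in: "N \<in> ratfuns_xy"
    unfolding N_def using ab sq by (simp add: ratfuns_xy_closed power2_eq_square)
  show ?thesis
  proof (cases "N = 0")
    \<comment> \<open>The norm vanishes also if \<open>a = b * s\<close>, which is possible when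
      \<open>s\<close> is itself rational; then \<open>z\<close> is the rational function
      \<open>a + a\<close>.\<close>
    case True
    then have "z = 0 \<or> z = a + a" using N by (auto simp: ab(3))
    then have "z \<in> ratfuns_xy"
      using ratfuns_xy_add[OF ab(1) ab(1)] ratfuns_xy_simple(1) by metis
    then show ?thesis by (simp add: quadratic_ext_base ratfuns_xy_closed)
  next
    case False
    then have "z \<noteq> 0" "a - b * s \<noteq> 0" using N by auto
    then have "inverse z = (a - b * s) * inverse N" unfolding N by (simp add: inverse_eq_divide)
    then have "inverse z = a * inverse N + (- b * inverse N) * s" by (simp add: algebra_simps)
    then show ?thesis
      using ab N_in by (intro quadratic_extI[of "a * inverse N" "- b * inverse N"])
        (auto simp: ratfuns_xy_closed)
  qed
qed

lemma quadratic_ext_sum: "(\<And>i. i \<in> I \<Longrightarrow> f i \<in> quadratic_ext s) \<Longrightarrow> sum f I \<in> quadratic_ext s"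
  by (induction I rule: infinite_finite_induct)
    (auto simp: quadratic_ext_base quadratic_ext_add ratfuns_xy_closed)

lemma quadratic_ext_power: "z \<in> quadratic_ext s \<Longrightarrow> z ^ n \<in> quadratic_ext s"
  by (induction n) (auto simp: quadratic_ext_base quadratic_ext_mult ratfuns_xy_closed)

lemma quadratic_ext_of_nat: "of_nat n \<in> quadratic_ext s"
  by (induction n) (auto simp: quadratic_ext_base quadratic_ext_add ratfuns_xy_closed)

lemma quadratic_ext_diff: "y \<in> quadratic_ext s \<Longrightarrow> z \<in> quadratic_ext s \<Longrightarrow> y - z \<in> quadratic_ext s"
  using quadratic_ext_add[of y "(- 1) * z"] quadratic_ext_mult[of "- 1" z]
  by (simp add: quadratic_ext_base ratfuns_xy_closed)

lemma quadratic_ext_algebraic: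
  assumes "z \<in> quadratic_ext s"
  shows "algebraic_over ratfuns_xy z"
proof -
  from assms obtain a b where ab: "a \<in> ratfuns_xy" "b \<in> ratfuns_xy" "z = a + b * s"
    by (auto simp: quadratic_ext_def)
  define p where "p = [:a ^ 2 - b ^ 2 * s ^ 2, - (a + a), 1:]"
  have "coeff p i \<in> ratfuns_xy" for i
  proof -
    have "coeff p i \<in> {a ^ 2 - b ^ 2 * s ^ 2, - (a + a), 1, 0}"
      by (auto simp: p_def coeff_pCons split: nat.splits)
    moreover have "- (a + a) \<in> ratfuns_xy" using ab by (intro ratfuns_xy_uminus ratfuns_xy_add)
    then have "{a ^ 2 - b ^ 2 * s ^ 2, - (a + a), 1, 0} \<subseteq> ratfuns_xy"
      using ab sq by (simp add: ratfuns_xy_closed power2_eq_square)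
    ultimately show ?thesis by blast
  qed
  moreover have "poly p z = 0" by (simp add: p_def ab(3) algebra_simps power2_eq_square)
  moreover have "p \<noteq> 0" by (simp add: p_def)
  ultimately show ?thesis by (auto simp: algebraic_over_def)
qed

end

text \<open>Over the common denominator \<open>B * D\<close>, the element becomes a polynomial of
  degree at most 1 in the third variable. The denominator is free of that variable, so it cannot
  vanish under the evaluation.\<close>

lemma quadratic_ext_ratfun_value:
  assumes "z \<in> quadratic_ext (to_fract w)"
  shows "\<exists>F. ratfun_has_value F varx vary w z"
proof -
  from assms obtain a b where ab: "a \<in> ratfuns_xy" "b \<in> ratfuns_xy" "z = a + b * to_fract w"
    by (auto simp: quadratic_ext_def)
  obtain A B where a: "eval_xy B \<noteq> 0" "a = eval_xy A / eval_xy B"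
    using ab(1) by (auto simp: ratfuns_xy_iff simp del: to_fract_eq_0_iff)
  obtain C D where b: "eval_xy D \<noteq> 0" "b = eval_xy C / eval_xy D"
    using ab(2) by (auto simp: ratfuns_xy_iff simp del: to_fract_eq_0_iff)
  define P where "P = [:A * D, C * B:]"
  define Q where "Q = [:B * D:]"
  have "to_fract (eval3 P varx vary w) = eval_xy A * eval_xy D + to_fract w * (eval_xy C * eval_xy B)"
    by (simp add: P_def eval3_simps eval2_simps)
  moreover have Q: "to_fract (eval3 Q varx vary w) = eval_xy B * eval_xy D"
    by (simp add: Q_def eval3_simps eval2_simps)
  ultimately have "z = to_fract (eval3 P varx vary w) / to_fract (eval3 Q varx vary w)"
    unfolding ab(3) a(2) b(2) using a(1) b(1) by (simp add: divide_simps mult.commute del: to_fract_eq_0_iff)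
  moreover have "eval3 Q varx vary w \<noteq> 0" using Q a b by (metis mult_eq_0_iff to_fract_eq_0_iff)
  ultimately show ?thesis unfolding ratfun_has_value_def by blast
qed

section \<open>The square root of the discriminant and the inverse substitution\<close>

definition disc_sqrt :: "real fps fps" where
  "disc_sqrt = fps2_sqrt ((varx + varx * vary - 1) ^ 2 - 4 * varx ^ 2 * vary)"

lemma disc_sqrt_square: "disc_sqrt ^ 2 = (varx + varx * vary - 1) ^ 2 - 4 * varx ^ 2 * vary"
  unfolding disc_sqrt_def by (rule fps2_sqrt_disc)

lemma disc_sqrt_nth_0: "disc_sqrt $ 0 = 1"
proof -
  have "(disc_sqrt $ 0) ^ 2 = (disc_sqrt ^ 2) $ 0" by (simp add: power2_eq_square)
  also have "\<dots> = 1"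
    by (subst disc_sqrt_square) (simp add: varx_def vary_def power2_eq_square)
  finally have "disc_sqrt $ 0 = 1 \<or> disc_sqrt $ 0 = - 1" by (simp add: power2_eq_1_iff)
  moreover have "disc_sqrt $ 0 $ 0 = 1" unfolding disc_sqrt_def by (rule fps2_sqrt_disc)
  ultimately show ?thesis by auto
qed

lemma disc_sqrt_square_ratfun: "to_fract disc_sqrt ^ 2 \<in> ratfuns_xy"
proof -
  have "to_fract disc_sqrt ^ 2 = to_fract (disc_sqrt ^ 2)" by (simp add: power2_eq_square)
  also have "disc_sqrt ^ 2 = (varx + varx * vary - 1) * (varx + varx * vary - 1) - const2 4 * (varx * varx) * vary"
    by (subst disc_sqrt_square) (simp add: const2_def power2_eq_square flip: numeral_fps_const)
  finally show ?thesis by (simp add: ratfuns_xy_closed)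
qed

text \<open>\<open>xi\<close> is the compositional inverse of \<^const>\<open>leaf_subst\<close>, i.e. the root
  \<open>2 x / (1 - x - x y + sqrt D)\<close> of \<open>\<xi> = x (1 + \<xi>) (1 + \<xi> y)\<close>.\<close>
definition xi_denom :: "real fps fps" where
  "xi_denom = fps_const (fps_const (1/2)) * (1 - varx - varx * vary + disc_sqrt)"

definition xi :: "real fps fps" where
  "xi = varx * (geo 1 oo (1 - xi_denom))"

text \<open>\<open>geo 1\<close> composed with \<open>1 - xi_denom\<close> is the geometric series
  of \<open>1 / xi_denom\<close>; it makes sense because \<open>xi_denom\<close> has the coefficient
  \<open>(1 + 1) / 2 = 1\<close> at \<open>x ^ 0\<close>.\<close>

lemma xi_denom_mult: "xi * xi_denom = varx"
proof -
  have "(1 - xi_denom) $ 0 = 0"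
    by (simp add: xi_denom_def disc_sqrt_nth_0 varx_def numeral_fps_const)
  from geo_eq_compose[OF this, of 1] show ?thesis by (simp add: xi_def mult.assoc)
qed

lemma xi_denom_nonzero: "xi_denom \<noteq> 0"
  using xi_denom_mult by (auto simp: varx_def)

lemma xi_nth_0: "xi $ 0 = 0"
  by (simp add: xi_def varx_def)

text \<open>With \<open>xi * d = x\<close>, multiplying by \<open>d * d\<close> turns the equation
  into the quadratic equation of \<open>d = (M + disc_sqrt) / 2\<close>, times \<open>- x\<close>.
  As \<open>d\<close> is nonzero and there are no zero divisors, the multiplication can be
  undone.\<close>

lemma xi_equation: "xi = varx * (1 + xi) * (1 + xi * vary)"
proof -
  define d where "d = xi_denom"
  define h where "h = (fps_const (fps_const (1/2)) :: real fps fps)"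
  have h: "h * 2 = 1"
    by (simp add: h_def numeral_fps_const)
  define M where "M = 1 - varx - varx * vary"
  have d: "2 * d = M + disc_sqrt"
  proof -
    have "2 * d = (h * 2) * (M + disc_sqrt)"
      by (simp add: d_def xi_denom_def h_def M_def algebra_simps)
    then show ?thesis by (simp add: h)
  qed
  have "(2 * d - M) ^ 2 = M ^ 2 - 4 * varx ^ 2 * vary"
    unfolding d using disc_sqrt_square by (simp add: M_def algebra_simps power2_eq_square)
  then have q4: "4 * (d * d - d * M + varx * varx * vary) = 0"
    by (simp add: algebra_simps power2_eq_square)
  have "d * d - d * M + varx * varx * vary = (h * 2) * (h * 2) * (d * d - d * M + varx * varx * vary)"
    unfolding h by simp
  also have "\<dots> = h * h * (4 * (d * d - d * M + varx * varx * vary))"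
    by (simp add: algebra_simps)
  finally have q: "d * d - d * M + varx * varx * vary = 0" unfolding q4 by simp
  have x: "xi * d = varx" unfolding d_def by (rule xi_denom_mult)
  have "d * d * (xi - varx * (1 + xi) * (1 + xi * vary)) =
      (xi * d) * d - varx * (d + xi * d) * (d + (xi * d) * vary)"
    by (simp add: algebra_simps)
  also have "\<dots> = varx * d - varx * (d + varx) * (d + varx * vary)"
    by (simp only: x)
  also have "\<dots> = - varx * (d * d - d * M + varx * varx * vary)"
    by (simp add: M_def algebra_simps)
  finally show ?thesis using q xi_denom_nonzero by (simp add: d_def)
qed

lemma leaf_subst_xi: "leaf_subst oo xi = varx" "(geo (- fps_X) oo xi) * (1 + xi * vary) = 1"
proof -
  have g1: "(geo (- 1) oo xi) * (1 + xi) = 1"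
    using geo_eq_compose[OF xi_nth_0, of "- 1"] by (simp flip: fps_const_neg)
  show g2: "(geo (- fps_X) oo xi) * (1 + xi * vary) = 1"
    using geo_eq_compose[OF xi_nth_0, of "- fps_X"]
    by (simp add: vary_def mult.commute flip: fps_const_neg)
  have "leaf_subst oo xi = xi * (geo (- 1) oo xi) * (geo (- fps_X) oo xi)"
    by (simp add: leaf_subst_def fps_compose_mult_distrib xi_nth_0)
  also have "\<dots> = varx * ((geo (- 1) oo xi) * (1 + xi)) * ((geo (- fps_X) oo xi) * (1 + xi * vary))"
    by (subst (1) xi_equation) (simp add: ac_simps)
  finally show "leaf_subst oo xi = varx" by (simp add: g1 g2)
qed

section \<open>Membership of the generating function in the extension\<close>

abbreviation disc_field :: "real fps fps fract set" where
  "disc_field \<equiv> quadratic_ext (to_fract disc_sqrt)"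

lemmas disc_field_closed = ratfuns_xy_closed
  quadratic_ext_base[OF disc_sqrt_square_ratfun] quadratic_ext_gen[OF disc_sqrt_square_ratfun]
  quadratic_ext_add[OF disc_sqrt_square_ratfun] quadratic_ext_mult[OF disc_sqrt_square_ratfun]
  quadratic_ext_inverse[OF disc_sqrt_square_ratfun] quadratic_ext_sum[OF disc_sqrt_square_ratfun]
  quadratic_ext_power[OF disc_sqrt_square_ratfun] quadratic_ext_of_nat[OF disc_sqrt_square_ratfun]
  quadratic_ext_diff[OF disc_sqrt_square_ratfun]

lemma inverse_in_disc_field:
  assumes "u * v = 1" "to_fract v \<in> disc_field"
  shows "to_fract u \<in> disc_field"
proof -
  have "to_fract u * to_fract v = 1" using assms(1) by (metis to_fract_1 to_fract_mult)
  then have "to_fract u = inverse (to_fract v)" by (metis inverse_unique mult.commute)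
  then show ?thesis using assms(2) by (simp add: disc_field_closed)
qed

lemma xi_in_field: "to_fract xi \<in> disc_field"
proof -
  have "to_fract xi_denom \<in> disc_field"
    unfolding xi_denom_def by (simp add: disc_field_closed flip: const2_def)
  moreover have "to_fract xi * to_fract xi_denom = to_fract varx"
    by (metis to_fract_mult xi_denom_mult)
  then have "to_fract xi = to_fract varx * inverse (to_fract xi_denom)"
    using xi_denom_nonzero by (simp add: field_simps)
  ultimately show ?thesis by (simp add: disc_field_closed)
qed

lemma to_fract_power: "to_fract (u ^ n) = to_fract u ^ n"
  by (induction n) simp_all

lemma to_fract_of_nat: "to_fract (of_nat n) = of_nat n"
  by (induction n) simp_all

text \<open>Substituting \<open>xi\<close> for \<open>x\<close> undoes \<open>leaf_subst\<close>,
  and it turns the finite sum for \<open>r\<close> into a polynomial in \<open>xi\<close>,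
  \<open>y\<close> and \<open>1 / (1 - y * xi ^ 2)\<close>, all of them in the field.\<close>

lemma gf_in_field:
  fixes q :: "nat \<Rightarrow> nat \<Rightarrow> nat"
  assumes pr: "two_var_gf r = (two_var_gf p oo leaf_subst) * geo (- fps_X)"
    and rq: "two_var_gf r = (\<Sum>N\<le>M. \<Sum>K\<le>M. of_nat (q N K) *
      (fps_X ^ N * vary ^ K * (geo fps_X oo fps_X ^ 2) ^ K))"
  shows "to_fract (two_var_gf p) \<in> disc_field"
proof -
  have X2: "(fps_X ^ 2 :: real fps fps) $ 0 = 0" by simp
  have L0: "leaf_subst $ 0 = 0" by (simp add: leaf_subst_def)
  define G where "G = (geo fps_X oo fps_X ^ 2) oo xi"
  have "((geo fps_X oo fps_X ^ 2) * (1 - fps_const fps_X * fps_X ^ 2)) oo xi = 1"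
    by (simp only: geo_eq_compose[OF X2] fps_compose_1)
  then have "G * (1 - vary * xi ^ 2) = 1"
    by (simp add: G_def vary_def fps_compose_mult_distrib fps_compose_sub_distrib xi_nth_0
        fps_compose_power[OF xi_nth_0, symmetric])
  then have G_in: "to_fract G \<in> disc_field"
    by (rule inverse_in_disc_field) (simp add: disc_field_closed to_fract_power xi_in_field)
  have "two_var_gf r oo xi = (\<Sum>N\<le>M. \<Sum>K\<le>M. of_nat (q N K) * (xi ^ N * vary ^ K * G ^ K))"
    unfolding rq G_def
    by (simp add: fps_compose_sum_distrib fps_compose_mult_distrib xi_nth_0 vary_def fps_const_power
        fps_of_nat[symmetric] fps_compose_power[OF xi_nth_0, symmetric])
  then have r_in: "to_fract (two_var_gf r oo xi) \<in> disc_field"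
    by (simp add: disc_field_closed to_fract_power to_fract_of_nat xi_in_field G_in)
  have "two_var_gf r oo xi = (two_var_gf p oo varx) * (geo (- fps_X) oo xi)"
    unfolding pr by (simp add: fps_compose_mult_distrib xi_nth_0 leaf_subst_xi(1)
        fps_compose_assoc[OF xi_nth_0 L0, symmetric])
  then have "(two_var_gf r oo xi) * (1 + xi * vary) = two_var_gf p"
    using leaf_subst_xi(2) by (simp add: mult.assoc varx_def)
  then have "to_fract (two_var_gf p) = to_fract (two_var_gf r oo xi) * to_fract (1 + xi * vary)"
    by (metis to_fract_mult)
  then show ?thesis using r_in by (simp add: disc_field_closed xi_in_field)
qed

lemma genus_gf_in_disc_field:
  "to_fract (two_var_gf (\<lambda>n k. card (genus_class g n k))) \<in> disc_field"
proof (rule gf_in_field)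
  show "two_var_gf (\<lambda>n k. card (reduced_class g n k)) =
      (two_var_gf (\<lambda>n k. card (genus_class g n k)) oo leaf_subst) * geo (- fps_X)"
    by (rule inclusion_exclusion_gf[where w = "weight g"])
      (simp_all add: card_reduced_class weight_eq_0 weight_eq)
  have "N \<le> 24 * g \<and> K \<le> 24 * g" if "card (chord_class g 0 N K) \<noteq> 0" for N K
  proof -
    obtain \<alpha> where \<alpha>: "\<alpha> \<in> chord_class g 0 N K" using \<open>_ \<noteq> 0\<close> by fastforce
    then have "K = card (descents N \<alpha>)" using chord_class_subset[of g 0 N K] by (auto simp: genus_class_def)
    also have "\<dots> \<le> card {1..N}" by (rule card_mono) (auto simp: descents_def)
    finally show ?thesis using chord_free_bound[OF \<alpha>] by simp
  qed
  then show "two_var_gf (\<lambda>n k. card (reduced_class g n k)) =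
      (\<Sum>N\<le>24 * g. \<Sum>K\<le>24 * g. of_nat (card (chord_class g 0 N K)) *
        (fps_X ^ N * vary ^ K * (geo fps_X oo fps_X ^ 2) ^ K))"
    by (intro chord_gf[where c = "\<lambda>j n k. card (chord_class g j n k)"])
      (auto simp: card_reduced_class_chords chord_class_empty card_chord_class)
qed

text \<open>The correction is the empty partition: it has genus 0 in the sense of
  \<open>genus_class\<close>, owing to the extra point 0 in \<open>faces\<close>, but
  \<open>partition_gf\<close> starts at \<open>n = 1\<close>.\<close>

lemma partition_gf_eq:
  "partition_gf g = two_var_gf (\<lambda>n k. card (genus_class g n k)) - of_nat (if g = 0 then 1 else 0)"
proof (intro fps_ext)
  fix n k
  have "partition_gf g $ n $ k =
      real (card (genus_class g n k)) - (if g = 0 \<and> n = 0 \<and> k = 0 then 1 else 0)"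
  proof (cases "n = 0 \<or> k = 0")
    case True
    then show ?thesis
      by (cases "n = 0") (auto simp: partition_gf_def genus_class_0 genus_class_no_parts)
  next
    case False
    then show ?thesis by (simp add: partition_gf_def num_partitions_eq)
  qed
  then show "partition_gf g $ n $ k = (two_var_gf (\<lambda>n k. card (genus_class g n k)) -
      of_nat (if g = 0 then 1 else 0)) $ n $ k"
    by (simp add: two_var_gf_def)
qed

theorem theorem6p10:
  fixes g :: nat
  shows "algebraic_over ratfuns_xy (to_fract (partition_gf g)) \<and>
    (\<exists>F. ratfun_has_value F varx vary
           (fps2_sqrt ((varx + varx * vary - 1) ^ 2 - 4 * varx ^ 2 * vary))
           (to_fract (partition_gf g)))"
proof -
  have "to_fract (partition_gf g) \<in> disc_field"
    unfolding partition_gf_eq to_fract_diff to_fract_of_nat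
    by (intro disc_field_closed genus_gf_in_disc_field)
  then show ?thesis
    using quadratic_ext_algebraic[OF disc_sqrt_square_ratfun] quadratic_ext_ratfun_value
    by (simp add: disc_sqrt_def)
qed

end
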